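(* Let $n\ge 13$ be an integer and suppose $n=5k+3l$ with integers $k$ and $l$, $0\le l\le 4$. Then $$\operatorname{Pg}(n)\le 2n+k+l,$$ where $\operatorname{Pg}(n)$ is the minimum number of pentagons in a $3$-connected pentagulation of an $n$-gon.
   Context: All graphs are finite, undirected and simple (no loops, no multiple edges). A pentagulation of an $n$-gon (of a simple cycle $C_n$ of length $n\ge 3$ in the plane) is a connected plane graph all of whose faces have length five, except for one face, which has length $n$ and is bounded by the cycle $C_n$; its number of pentagons is the number of faces of length five other than the distinguished face bounded by $C_n$. A graph $G$ is $k$-connected if $|V(G)|>k$ and deleting any at most $k-1$ vertices leaves a connected graph. $\operatorname{Pg}(n)$ denotes the smallest number of pentagons among all $3$-connected pentagulations of an $n$-gon. *)

theory Defs
  imports "HOL-Analysis.Analysis" "HOL-Library.Extended_Nat" "Graph_Theory.Graph_Theory"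
begin

text \<open>
  A simple plane graph is a pair \<open>(V, E)\<close> of a finite set \<open>V\<close> of points of the plane (the complex
  numbers) and a finite set \<open>E\<close> of point sets, the edges.  Every edge is an arc joining two points
  of \<open>V\<close> and has no vertex in its interior, different edges have different pairs of end points, and
  two different edges meet in vertices only.  The end points of an edge \<open>e\<close> are therefore exactly
  the elements of \<open>e \<inter> V\<close>.
\<close>

definition plane_graph :: "complex set \<Rightarrow> complex set set \<Rightarrow> bool" where
  "plane_graph V E \<longleftrightarrow>
     finite V \<and> finite E \<and>
     (\<forall>e\<in>E. \<exists>g. arc g \<and> path_image g = e \<and> e \<inter> V = {pathstart g, pathfinish g}) \<and>
     (\<forall>e\<in>E. \<forall>e'\<in>E. e \<noteq> e' \<longrightarrow> e \<inter> V \<noteq> e' \<inter> V \<and> e \<inter> e' \<subseteq> V)"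

text \<open>
  The abstract graph of a plane graph, as a symmetric digraph: each edge contributes both of its
  orientations.
\<close>

definition abstract_graph :: "complex set \<Rightarrow> complex set set \<Rightarrow> (complex, complex \<times> complex) pre_digraph" where
  "abstract_graph V E =
     \<lparr> verts = V, arcs = {(u, v). \<exists>e\<in>E. e \<inter> V = {u, v}}, tail = fst, head = snd \<rparr>"

definition k_connected :: "nat \<Rightarrow> ('a, 'b) pre_digraph \<Rightarrow> bool" where
  "k_connected k G \<longleftrightarrow>
     k < card (verts G) \<and>
     (\<forall>S. S \<subseteq> verts G \<and> card S < k \<longrightarrow>
        Digraph_Component.connected (induce_subgraph G (verts G - S)))"

definition plane_faces :: "complex set \<Rightarrow> complex set set \<Rightarrow> complex set set" where
  "plane_faces V E = components (- (V \<union> \<Union>E))"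

text \<open>
  The length of a face of a connected plane graph is the length of its boundary walk: an edge
  on the boundary counts once if it also borders another face, and twice if the face lies on both
  of its sides.
\<close>

definition face_length :: "complex set \<Rightarrow> complex set set \<Rightarrow> complex set \<Rightarrow> nat" where
  "face_length V E F =
     (\<Sum>e \<in> {e \<in> E. e \<subseteq> frontier F}.
        if \<exists>F' \<in> plane_faces V E. F' \<noteq> F \<and> e \<subseteq> frontier F' then 1 else 2)"

text \<open>
  In the symmetric digraph, \<open>pre_digraph.cycle\<close> also admits walks of length two back and forth
  along one edge; these are excluded by the condition \<open>3 \<le> length p\<close>.
\<close>

definition bounded_by_cycle :: "complex set \<Rightarrow> complex set set \<Rightarrow> complex set \<Rightarrow> nat \<Rightarrow> bool" where
  "bounded_by_cycle V E F n \<longleftrightarrow>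
     (\<exists>p. pre_digraph.cycle (abstract_graph V E) p \<and> length p = n \<and> 3 \<le> length p \<and>
          frontier F = \<Union>{e \<in> E. \<exists>(u, v) \<in> set p. e \<inter> V = {u, v}})"

text \<open>The distinguished face \<open>F\<close> of length \<open>n\<close> may be any face, bounded or not.\<close>

definition pentagulation :: "nat \<Rightarrow> complex set \<Rightarrow> complex set set \<Rightarrow> complex set \<Rightarrow> bool" where
  "pentagulation n V E F \<longleftrightarrow>
     plane_graph V E \<and> Digraph_Component.connected (abstract_graph V E) \<and>
     F \<in> plane_faces V E \<and> face_length V E F = n \<and> bounded_by_cycle V E F n \<and>
     (\<forall>F' \<in> plane_faces V E. F' \<noteq> F \<longrightarrow> face_length V E F' = 5)"

definition num_pentagons :: "complex set \<Rightarrow> complex set set \<Rightarrow> complex set \<Rightarrow> nat" where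
  "num_pentagons V E F = card {F' \<in> plane_faces V E. F' \<noteq> F \<and> face_length V E F' = 5}"

text \<open>
  The minimum is taken in the extended natural numbers, so that it is \<open>\<infinity>\<close> if there is no
  3-connected pentagulation of an \<open>n\<close>-gon; a finite upper bound thus includes existence.
\<close>

definition Pg :: "nat \<Rightarrow> enat" where
  "Pg n = Inf {enat (num_pentagons V E F) | V E F.
                 pentagulation n V E F \<and> k_connected 3 (abstract_graph V E)}"

end

theory Submission
  imports Defs
begin

text \<open>
  Take three concentric levels. The outer cycle has \<open>n\<close> vertices, each joined by a ray to every
  second vertex of a middle cycle of length \<open>2 n\<close>; this gives \<open>n\<close> pentagons. The remaining \<open>n\<close>
  middle vertices are joined inwards to the successive vertices of a closed walk of length \<open>n\<close>,
  which gives another \<open>n\<close> pentagons. The closed walk is the boundary of \<open>k + l\<close> pentagons that all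
  contain the centre (the hub): \<open>k - 1\<close> single petals and one fan of \<open>l + 1\<close> pentagons, consecutive
  ones of which share an edge at the hub. In total there are \<open>2 n + k + l\<close> pentagons. In polar
  coordinates all edges and all faces are rectangles with integer corners, so the topology reduces
  to integer arithmetic.
\<close>

text \<open>The form n = 5k + 3l is a boundary count. A pentagon at the hub that shares no edge with
  another one adds its five sides to the closed walk; in a fan each pentagon adds only its three
  sides away from the hub, and the whole fan adds two hub edges. This gives 5(k - 1) + 3(l + 1) + 2
  = n, provided that k >= 1. The middle length 2n is forced: a pentagon of either band has one side
  on the outer cycle or the walk and two edges between the levels, hence two sides on the middle
  cycle. For k >= 2 the hub separates the inner level; it is the middle cycle that holds the petals
  together.

  The geometric obstacle is the angle: it is undefined at the hub and elsewhere determined only up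
  to full turns. Incidences are therefore treated at positive radius, with the hub apart, and angles
  stay unreduced, so that each argument can pick the copy of a rectangle that contains the point at
  hand. Every rectangle is narrow compared with a full turn, so two copies in the same place have
  shift 0.\<close>

lemma connected_induced_plane:
  fixes V W :: "complex set" and E :: "complex set set"
  defines "R \<equiv> {(u, v). u \<in> W \<and> v \<in> W \<and> (\<exists>e\<in>E. e \<inter> V = {u, v})}"
  assumes "r \<in> W" and reach: "\<And>v. v \<in> W \<Longrightarrow> (r, v) \<in> R\<^sup>*"
  shows "Digraph_Component.connected (induce_subgraph (abstract_graph V E) W)"
proof -
  let ?G = "induce_subgraph (abstract_graph V E) W"
  let ?H = "mk_symmetric ?G"
  have R: "(u, v) \<in> R \<longleftrightarrow> u \<in> W \<and> v \<in> W \<and> (\<exists>e\<in>E. e \<inter> V = {u, v})" for u v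
    by (simp add: R_def)
  have swap: "(v, u) \<in> R" if "(u, v) \<in> R" for u v
    using that unfolding R by (simp add: insert_commute)
  have arcs: "arcs ?G = R"
  proof (rule set_eqI)
    fix p show "p \<in> arcs ?G \<longleftrightarrow> p \<in> R"
      by (cases p) (simp add: R abstract_graph_def conj_commute conj_left_commute)
  qed
  \<comment> \<open>Both orientations of an edge are arcs already, so the symmetric closure adds
    nothing and connectedness becomes reachability in \<open>R\<close>.\<close>
  have "parcs ?H = (\<Union>(u, v)\<in>R. {(u, v), (v, u)})"
    unfolding parcs_mk_symmetric arcs by (simp add: abstract_graph_def case_prod_unfold)
  also have "\<dots> = R"
    using swap by blast
  finally have par: "parcs ?H = R" .
  have "sym R" using swap by (rule symI)
  then have "sym (R\<^sup>*)" by (rule sym_rtrancl)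
  then have "(u, v) \<in> R\<^sup>*" if "u \<in> W" "v \<in> W" for u v
    using reach[OF that(1)] reach[OF that(2)] by (meson rtrancl_trans symD)
  then have "(u, v) \<in> rtrancl_on W R" if "u \<in> W" "v \<in> W" for u v
    using that by (intro rtrancl_consistent_rtrancl_on) (simp_all add: R)
  then have "strongly_connected (with_proj ?H)"
    using \<open>r \<in> W\<close> by (intro strongly_connectedI) (auto simp: reachable_def par)
  then show ?thesis by (simp add: Digraph_Component.connected_def)
qed

text \<open>Applied to three disjoint escape routes of a vertex: two deletions cannot block them
  all.\<close>

lemma disjoint_from_small_set:
  assumes "finite S" "card S < 3" "A \<inter> B = {}" "A \<inter> C = {}" "B \<inter> C = {}"
  shows "A \<inter> S = {} \<or> B \<inter> S = {} \<or> C \<inter> S = {}"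
proof (rule ccontr)
  assume "\<not> ?thesis"
  then obtain a b c where abc: "a \<in> A" "b \<in> B" "c \<in> C" "{a, b, c} \<subseteq> S" by blast
  then have "card {a, b, c} = 3" using assms(3-5) by (auto simp: card_insert_if)
  then show False using card_mono[OF assms(1) abc(4)] assms(2) by simp
qed

lemma subset_doubleton_if_card_less_3:
  assumes "finite S" "card S < 3"
  obtains u v where "S \<subseteq> {u, v}"
proof -
  consider "card S = 0" | "card S = 1" | "card S = 2" using assms(2) by linarith
  then show thesis
  proof cases
    case 1
    then show thesis using that[of undefined undefined] assms(1) by simp
  next
    case 2
    then obtain u where "S = {u}" by (rule card_1_singletonE)
    then show thesis using that[of u u] by simp
  next
    case 3
    then show thesis using that by (auto simp: card_2_iff)
  qed
qed

subsection \<open>The wheel pattern in integer coordinates\<close>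

text \<open>
  The slot of \<open>i\<close> says what lies below the \<open>i\<close>-th inward edge of the middle cycle: for
  \<open>Spoke\<close> the hub itself, otherwise a vertex of the inner level. That vertex is joined to the hub
  for \<open>Start\<close> and \<open>Stop\<close>. Each \<open>Start\<close> opens a pentagon at the hub, which ends three slots later.
\<close>

datatype slot = Start | Left | Right | Stop | Spoke

text \<open>The transitions form two loops through \<open>Start\<close>: one of length three, for a
  hub pentagon followed directly by another, and one of length five, which ends a fan with
  \<open>Stop\<close> and \<open>Spoke\<close>. \<open>n_ge\<close> leaves room for three windows of
  three slots around the hub.\<close>

locale pentagon_pattern =
  fixes n :: nat and t :: "int \<Rightarrow> slot"
  assumes n_ge: "9 \<le> n"
    and t_periodic: "t (i + int n) = t i"
    and t_step: "(t i, t (i + 1)) \<in>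
      {(Start, Left), (Left, Right), (Right, Start), (Right, Stop), (Stop, Spoke), (Spoke, Start)}"
begin

definition T :: "int \<Rightarrow> slot" where "T x = t (x div 2)"

lemma T_step: "(T x, T (x + 2)) \<in>
    {(Start, Left), (Left, Right), (Right, Start), (Right, Stop), (Stop, Spoke), (Spoke, Start)}"
  using t_step[of "x div 2"] by (simp add: T_def)

lemma T_next:
  "T x = Start \<Longrightarrow> T (x + 2) = Left"
  "T x = Left \<Longrightarrow> T (x + 2) = Right"
  "T x = Right \<Longrightarrow> T (x + 2) \<in> {Start, Stop}"
  "T x = Stop \<Longrightarrow> T (x + 2) = Spoke"
  "T x = Spoke \<Longrightarrow> T (x + 2) = Start"
  using T_step[of x] by auto

lemma T_prev:
  "T x = Start \<Longrightarrow> T (x - 2) \<in> {Right, Spoke}"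
  "T x = Left \<Longrightarrow> T (x - 2) = Start"
  "T x = Right \<Longrightarrow> T (x - 2) = Left"
  "T x = Stop \<Longrightarrow> T (x - 2) = Right"
  "T x = Spoke \<Longrightarrow> T (x - 2) = Stop"
  using T_step[of "x - 2"] by auto

lemma T_petal:
  assumes "T x = Start"
  shows "T (x + 2) = Left" "T (x + 4) = Right" "T (x + 6) \<in> {Start, Stop}"
  using assms T_next(1)[of x] T_next(2)[of "x + 2"] T_next(3)[of "x + 4"] by (simp_all add: add.assoc)

text \<open>
  The integer pair \<open>(x, r)\<close> stands for the point with radius \<open>r\<close> and polar angle \<open>\<pi> x / n\<close>.
  \<open>edge a b r s\<close> and \<open>pent a b r s\<close> select the closed, respectively open, polar rectangles over
  \<open>[a, b] \<times> [r, s]\<close> that are edges, respectively pentagonal faces. Angles are not reduced modulo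
  \<open>2 n\<close>, so every vertex, edge and face occurs infinitely often. In the lemmas below, \<open>(X, Y)\<close> is
  the encoding of a point by the function \<open>code\<close> defined further down.
\<close>

inductive vtx :: "int \<Rightarrow> int \<Rightarrow> bool" where
  hub: "vtx x 0"
| inner: "even x \<Longrightarrow> T x \<noteq> Spoke \<Longrightarrow> vtx x 1"
| middle: "vtx x 2"
| outer: "odd x \<Longrightarrow> vtx x 3"

inductive edge :: "int \<Rightarrow> int \<Rightarrow> int \<Rightarrow> int \<Rightarrow> bool" where
  outer_arc: "odd a \<Longrightarrow> edge a (a + 2) 3 3"
| middle_arc: "edge a (a + 1) 2 2"
| inner_arc: "even a \<Longrightarrow> T a \<notin> {Stop, Spoke} \<Longrightarrow> edge a (a + 2) 1 1"
| outer_ray: "odd a \<Longrightarrow> edge a a 2 3"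
| inner_ray: "even a \<Longrightarrow> T a \<noteq> Spoke \<Longrightarrow> edge a a 1 2"
| spoke: "even a \<Longrightarrow> T a = Spoke \<Longrightarrow> edge a a 0 2"
| hub_ray: "even a \<Longrightarrow> T a \<in> {Start, Stop} \<Longrightarrow> edge a a 0 1"

inductive pent :: "int \<Rightarrow> int \<Rightarrow> int \<Rightarrow> int \<Rightarrow> bool" where
  outer_pent: "odd a \<Longrightarrow> pent a (a + 2) 2 3"
| middle_pent: "even a \<Longrightarrow> T a \<notin> {Stop, Spoke} \<Longrightarrow> pent a (a + 2) 1 2"
| spoke_pent: "even a \<Longrightarrow> T a \<in> {Stop, Spoke} \<Longrightarrow> pent a (a + 2) 0 2"
| petal: "even a \<Longrightarrow> T a = Start \<Longrightarrow> pent a (a + 6) 0 1"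

section \<open>Incidences at a point given in doubled integer coordinates\<close>

lemma edge_at_nonvertex:
  assumes "edge a b r s" "2 * a \<le> X" "X \<le> 2 * b" "2 * r \<le> Y" "Y \<le> 2 * s" "0 < Y"
    and nv: "\<And>x y. vtx x y \<Longrightarrow> (X, Y) \<noteq> (2 * x, 2 * y)"
  obtains "odd a" "b = a + 2" "r = 3" "s = 3" "Y = 6" "2 * a < X" "X < 2 * a + 4"
  | "b = a + 1" "r = 2" "s = 2" "Y = 4" "X = 2 * a + 1"
  | "even a" "T a \<notin> {Stop, Spoke}" "b = a + 2" "r = 1" "s = 1" "Y = 2" "2 * a < X" "X < 2 * a + 4"
  | "odd a" "b = a" "r = 2" "s = 3" "Y = 5" "X = 2 * a"
  | "even a" "T a \<noteq> Spoke" "b = a" "r = 1" "s = 2" "Y = 3" "X = 2 * a"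
  | "even a" "T a = Spoke" "b = a" "r = 0" "s = 2" "Y < 4" "X = 2 * a"
  | "even a" "T a \<in> {Start, Stop}" "b = a" "r = 0" "s = 1" "Y = 1" "X = 2 * a"
  using assms(1)
proof cases
  case outer_arc
  have "X \<noteq> 2 * a" "X \<noteq> 2 * (a + 2)"
    using nv[OF vtx.outer, of a] nv[OF vtx.outer, of "a + 2"] assms(2-6) outer_arc by auto
  then show thesis using that(1) outer_arc assms by auto
next
  case middle_arc
  have "X \<noteq> 2 * a" "X \<noteq> 2 * (a + 1)"
    using nv[OF vtx.middle, of a] nv[OF vtx.middle, of "a + 1"] assms(2-6) middle_arc by auto
  then show thesis using that(2) middle_arc assms by auto
next
  case inner_arc
  have "X \<noteq> 2 * a" "X \<noteq> 2 * (a + 2)"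
    using nv[OF vtx.inner, of a] nv[OF vtx.inner, of "a + 2"] assms(2-6) inner_arc T_step[of a] by auto
  then show thesis using that(3) inner_arc assms by auto
next
  case outer_ray
  have "Y \<noteq> 4" "Y \<noteq> 6"
    using nv[of a 2] nv[of a 3] assms(2-6) outer_ray by (auto intro: vtx.intros)
  then show thesis using that(4) outer_ray assms by auto
next
  case inner_ray
  have "Y \<noteq> 2" "Y \<noteq> 4"
    using nv[of a 1] nv[of a 2] assms(2-6) inner_ray by (auto intro: vtx.intros)
  then show thesis using that(5) inner_ray assms by auto
next
  case spoke
  have "Y \<noteq> 4"
    using nv[OF vtx.middle, of a] assms(2-6) spoke by auto
  then show thesis using that(6) spoke assms by auto
next
  case hub_ray
  have "Y \<noteq> 2"
    using nv[OF vtx.inner, of a] assms(2-6) hub_ray by auto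
  then show thesis using that(7) hub_ray assms by auto
qed

text \<open>Arcs of length two on the same level start at angles of equal parity, so they cannot
  overlap in their interiors. The one conceivable crossing, of a spoke with an inner arc at radius
  1, fails because a spoke has an even angle and the arc joins consecutive even angles.\<close>

lemma edge_unique:
  assumes e: "edge a b r s" "2 * a \<le> X" "X \<le> 2 * b" "2 * r \<le> Y" "Y \<le> 2 * s"
    and e': "edge a' b' r' s'" "2 * a' \<le> X" "X \<le> 2 * b'" "2 * r' \<le> Y" "Y \<le> 2 * s'"
    and Y: "0 < Y" and nv: "\<And>x y. vtx x y \<Longrightarrow> (X, Y) \<noteq> (2 * x, 2 * y)"
  shows "(a, b, r, s) = (a', b', r', s')"
proof -
  have par: "x = y" if "2 * x < X" "X < 2 * x + 4" "2 * y < X" "X < 2 * y + 4" "even x = even y" for x y :: int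
    using that by presburger
  have par2: False if "x < y" "2 * y < 2 * x + 4" "even x = even y" for x y :: int
    using that by presburger
  show ?thesis
    by (rule edge_at_nonvertex[OF e Y nv]; (assumption | rule edge_at_nonvertex[OF e' Y nv]; auto intro!: par dest: par2))
qed

lemma even_between:
  fixes a x :: int
  assumes "even a" "even x" "a < x"
  shows "x < a + 2 \<Longrightarrow> False" "x < a + 6 \<Longrightarrow> x = a + 2 \<or> x = a + 4"
  using assms by presburger+

text \<open>The only integer radius strictly inside a pentagon is 1, in a spoke pentagon; the angle
  there is \<open>a + 1\<close>, which is odd, while inner vertices have even angles.\<close>

lemma pent_no_vertex:
  assumes "pent a b r s" "a < x" "x < b" "r < y" "y < s" "vtx x y"
  shows False
  using assms by (auto elim!: pent.cases vtx.cases dest: even_between(1))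

lemma pent_no_edge:
  assumes f: "pent a' b' r' s'" "2 * a' < X" "X < 2 * b'" "2 * r' < Y" "Y < 2 * s'"
    and e: "edge a b r s" "2 * a \<le> X" "X \<le> 2 * b" "2 * r \<le> Y" "Y \<le> 2 * s"
    and Y: "0 < Y"
  shows False
proof -
  have nv: "(X, Y) \<noteq> (2 * x, 2 * y)" if "vtx x y" for x y
    using pent_no_vertex[of a' b' r' s' x y] that f by auto
  have odd: False if "odd x" "odd y" "2 * x < 2 * y" "2 * y < 2 * x + 4" for x y :: int
    using that by presburger
  have same: "x = y" if "even x" "even y" "2 * x < X" "X < 2 * x + 4" "2 * y < X" "X < 2 * y + 4" for x y :: int
    using that by presburger
  \<comment> \<open>The even angles strictly inside a petal carry \<open>Left\<close> and
    \<open>Right\<close>, which have no edge to the hub.\<close>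
  have pt: "T a \<noteq> Start \<and> T a \<noteq> Stop \<and> T a \<noteq> Spoke" if "T a' = Start" "even a'" "even a" "a' < a" "a < a' + 6"
    using even_between(2)[of a' a] that T_petal[of a'] by auto
  from f(1) show False
  proof cases
    case outer_pent
    show False
      by (rule edge_at_nonvertex[OF e Y nv]; (assumption | use f(2-) outer_pent odd[of a' a] in auto))
  next
    case middle_pent
    show False
      by (rule edge_at_nonvertex[OF e Y nv]; (assumption | use f(2-) middle_pent even_between(1)[of a' a] in auto))
  next
    case spoke_pent
    show False
      by (rule edge_at_nonvertex[OF e Y nv]; (assumption | use f(2-) spoke_pent even_between(1)[of a' a] same[of a a'] in auto))
  next
    case petal
    show False
      by (rule edge_at_nonvertex[OF e Y nv]; (assumption | use f(2-) petal pt in auto))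
  qed
qed

lemma pent_unique:
  assumes f: "pent a b r s" "2 * a < X" "X < 2 * b" "2 * r < Y" "Y < 2 * s"
    and f': "pent a' b' r' s'" "2 * a' < X" "X < 2 * b'" "2 * r' < Y" "Y < 2 * s'"
  shows "(a, b, r, s) = (a', b', r', s')"
proof -
  have same: "x = y" if "even x = even y" "2 * x < X" "X < 2 * x + 4" "2 * y < X" "X < 2 * y + 4" for x y :: int
    using that by presburger
  \<comment> \<open>A column of type \<open>Stop\<close> or \<open>Spoke\<close> that meets a petal
    would be one of the petal's own three columns, whose slots are \<open>Start\<close>,
    \<open>Left\<close> and \<open>Right\<close>.\<close>
  have mixed: False
    if "T x = Start" "T y \<in> {Stop, Spoke}" "even x" "even y" "2 * x < X" "X < 2 * x + 12" "2 * y < X" "X < 2 * y + 4" for x y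
  proof -
    have "y = x \<or> y = x + 2 \<or> y = x + 4" using that(3-) by presburger
    then show False using that(1,2) T_petal[of x] by auto
  qed
  have petals: "x \<le> y"
    if "T x = Start" "T y = Start" "even x" "even y" "2 * x < X" "2 * y < X" "X < 2 * x + 12" "X < 2 * y + 12" for x y
  proof (rule ccontr)
    assume "\<not> x \<le> y"
    then have "x = y + 2 \<or> x = y + 4" using that(3-) by presburger
    then show False using that(1,2) T_petal[of y] by auto
  qed
  show ?thesis
    using f(1)
  proof cases
    case outer_pent
    show ?thesis using f'(1) by cases (use outer_pent f(2-) f'(2-) same[of a a'] in auto)
  next
    case middle_pent
    show ?thesis using f'(1) by cases (use middle_pent f(2-) f'(2-) same[of a a'] in auto)
  next
    case spoke_pent
    show ?thesis using f'(1) by cases (use spoke_pent f(2-) f'(2-) same[of a a'] mixed[of a' a] in auto)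
  next
    case petal
    show ?thesis using f'(1)
      by cases (use petal f(2-) f'(2-) mixed[of a a'] petals[of a a'] petals[of a' a] in auto)
  qed
qed

lemma edge_or_pent:
  assumes "0 < Y" "Y \<le> 6"
  obtains (first) a b r s where "edge a b r s" "2 * a \<le> X" "X \<le> 2 * b" "2 * r \<le> Y" "Y \<le> 2 * s"
  | (second) a b r s where "pent a b r s" "2 * a < X" "X < 2 * b" "2 * r < Y" "Y < 2 * s"
proof -
  \<comment> \<open>Undoubled, \<open>e\<close> is the largest even and \<open>d\<close> the largest
    odd integer not above the angle: pentagons below radius 2 start at even angles, those above it
    at odd ones.\<close>
  define e where "e = 2 * (X div 4)"
  define d where "d = 2 * ((X - 2) div 4) + 1"
  have e: "even e" "2 * e \<le> X" "X < 2 * e + 4" and d: "odd d" "2 * d \<le> X" "X < 2 * d + 4"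
    unfolding e_def d_def by presburger+
  have Y: "Y = 6 \<or> Y = 5 \<or> Y = 4 \<or> Y = 3 \<or> Y = 2 \<or> Y = 1"
    using assms by presburger
  have spoke_side: thesis if "X \<noteq> 2 * e" "T e \<in> {Stop, Spoke}" "Y < 4"
    by (rule second[OF spoke_pent[of e]]) (use that e assms in simp_all)
  \<comment> \<open>The slot of column \<open>e\<close> tells how far back its petal started: 0, 2
    or 4.\<close>
  have petal_side: thesis if low: "T e \<notin> {Stop, Spoke}" "X \<noteq> 2 * e \<or> T e \<noteq> Start" "Y = 1"
  proof -
    consider "T e = Start" | "T e = Left" | "T e = Right"
      using low(1) by (cases "T e") auto
    then show thesis
    proof cases
      case 1
      then show thesis by (intro second[OF petal[of e]]) (use e low in auto)
    next
      case 2
      then show thesis by (intro second[OF petal[of "e - 2"]]) (use e low T_prev(2)[of e] in auto)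
    next
      case 3
      then show thesis
        by (intro second[OF petal[of "e - 4"]]) (use e low T_prev(3)[of e] T_prev(2)[of "e - 2"] in auto)
    qed
  qed
  from Y show thesis
  proof (elim disjE)
    assume "Y = 6"
    then show thesis by (intro first[OF outer_arc[of d]]) (use d in auto)
  next
    assume "Y = 5"
    then show thesis
      using first[OF outer_ray[of d]] second[OF outer_pent[of d]] d by (cases "X = 2 * d") auto
  next
    assume "Y = 4"
    then show thesis by (intro first[OF middle_arc[of "X div 2"]]) auto
  next
    assume Y: "Y = 3"
    show thesis
    proof (cases "X = 2 * e")
      case True
      then show thesis
        using first[OF spoke[of e]] first[OF inner_ray[of e]] e Y by (cases "T e = Spoke") auto
    next
      case False
      then show thesis
        using spoke_side second[OF middle_pent[of e]] e Y by (cases "T e \<in> {Stop, Spoke}") auto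
    qed
  next
    assume Y: "Y = 2"
    show thesis
    proof (cases "X = 2 * e")
      case True
      then show thesis
        using first[OF spoke[of e]] first[OF inner_ray[of e]] e Y by (cases "T e = Spoke") auto
    next
      case False
      then show thesis
        using spoke_side first[OF inner_arc[of e]] e Y by (cases "T e \<in> {Stop, Spoke}") auto
    qed
  next
    assume Y: "Y = 1"
    show thesis
    proof (cases "X = 2 * e")
      case True
      then show thesis
        using first[OF spoke[of e]] first[OF hub_ray[of e]] petal_side e Y by (cases "T e") auto
    next
      case False
      then show thesis
        using spoke_side petal_side Y by (cases "T e \<in> {Stop, Spoke}") auto
    qed
  qed
qed

lemma edge_vertex:
  assumes "edge a b r s" "vtx x y" "0 < y" "a \<le> x" "x \<le> b" "r \<le> y" "y \<le> s"
  shows "(x, y) = (a, r) \<or> (x, y) = (b, s)"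
proof -
  have "x = a \<or> x = a + 2" if "even x = even a" "b = a + 2"
    using that assms by presburger
  moreover have "x = a \<or> x = a + 1" if "b = a + 1"
    using that assms by presburger
  ultimately show ?thesis
    using assms by (auto elim!: edge.cases vtx.cases)
qed

text \<open>An edge lies on the boundary of a pentagon if and only if its midpoint does.\<close>

definition sides :: "int \<Rightarrow> int \<Rightarrow> int \<Rightarrow> int \<Rightarrow> (int \<times> int \<times> int \<times> int) set" where
  "sides a b r s = {(a', b', r', s'). edge a' b' r' s' \<and>
     2 * a \<le> a' + b' \<and> a' + b' \<le> 2 * b \<and> 2 * r \<le> r' + s' \<and> r' + s' \<le> 2 * s}"

lemma sides_outer_pent:
  assumes "odd a"
  shows "sides a (a + 2) 2 3 =
    {(a, a + 2, 3, 3), (a, a + 1, 2, 2), (a + 1, a + 2, 2, 2), (a, a, 2, 3), (a + 2, a + 2, 2, 3)}"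
  (is "?S = ?L")
proof
  show "?S \<subseteq> ?L"
  proof
    fix q assume "q \<in> ?S"
    then obtain a' b' r' s' where q: "q = (a', b', r', s')" and e: "edge a' b' r' s'"
      and le: "2 * a \<le> a' + b'" "a' + b' \<le> 2 * a + 4" "4 \<le> r' + s'" "r' + s' \<le> 6"
      by (auto simp: sides_def)
    \<comment> \<open>The value \<open>a - 1\<close> belongs to an arc of length two centred at
      angle \<open>a\<close>; parity or radius excludes it.\<close>
    have "a' = a - 1 \<or> a' = a \<or> a' = a + 1 \<or> a' = a + 2"
      using e le by cases presburger+
    then show "q \<in> ?L"
      using e le assms unfolding q by (elim disjE) (auto simp: edge.simps)
  qed
  show "?L \<subseteq> ?S"
    unfolding sides_def using assms by (auto simp: edge.simps)
qed

lemma sides_middle_pent: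
  assumes "even a" "T a \<notin> {Stop, Spoke}"
  shows "sides a (a + 2) 1 2 =
    {(a, a + 2, 1, 1), (a, a + 1, 2, 2), (a + 1, a + 2, 2, 2), (a, a, 1, 2), (a + 2, a + 2, 1, 2)}"
  (is "?S = ?L")
proof
  show "?S \<subseteq> ?L"
  proof
    fix q assume "q \<in> ?S"
    then obtain a' b' r' s' where q: "q = (a', b', r', s')" and e: "edge a' b' r' s'"
      and le: "2 * a \<le> a' + b'" "a' + b' \<le> 2 * a + 4" "2 \<le> r' + s'" "r' + s' \<le> 4"
      by (auto simp: sides_def)
    have "a' = a - 1 \<or> a' = a \<or> a' = a + 1 \<or> a' = a + 2"
      using e le by cases presburger+
    then show "q \<in> ?L"
      using e le assms T_step[of a] unfolding q by (elim disjE) (auto simp: edge.simps)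
  qed
  show "?L \<subseteq> ?S"
    unfolding sides_def using assms T_step[of a] by (auto simp: edge.simps)
qed

text \<open>Of the two straight walls, the one at the \<open>Spoke\<close> slot is a single edge,
  while the other is split at radius 1 into an inner ray and a hub ray. With the two middle arcs
  this makes five.\<close>

lemma sides_spoke_pent:
  assumes "even a" "T a \<in> {Stop, Spoke}"
  shows "sides a (a + 2) 0 2 =
    {(a, a + 1, 2, 2), (a + 1, a + 2, 2, 2)} \<union>
    (if T a = Stop then {(a, a, 1, 2), (a, a, 0, 1), (a + 2, a + 2, 0, 2)}
     else {(a, a, 0, 2), (a + 2, a + 2, 1, 2), (a + 2, a + 2, 0, 1)})"
  (is "?S = ?L")
proof
  show "?S \<subseteq> ?L"
  proof
    fix q assume "q \<in> ?S"
    then obtain a' b' r' s' where q: "q = (a', b', r', s')" and e: "edge a' b' r' s'"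
      and le: "2 * a \<le> a' + b'" "a' + b' \<le> 2 * a + 4" "0 \<le> r' + s'" "r' + s' \<le> 4"
      by (auto simp: sides_def)
    have "a' = a - 1 \<or> a' = a \<or> a' = a + 1 \<or> a' = a + 2"
      using e le by cases presburger+
    then show "q \<in> ?L"
      using e le assms T_step[of a] unfolding q by (elim disjE) (auto simp: edge.simps)
  qed
  show "?L \<subseteq> ?S"
    unfolding sides_def using assms T_step[of a] by (auto simp: edge.simps)
qed

lemma sides_petal:
  assumes "even a" "T a = Start"
  shows "sides a (a + 6) 0 1 =
    {(a, a + 2, 1, 1), (a + 2, a + 4, 1, 1), (a + 4, a + 6, 1, 1), (a, a, 0, 1), (a + 6, a + 6, 0, 1)}"
  (is "?S = ?L")
proof
  show "?S \<subseteq> ?L"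
  proof
    fix q assume "q \<in> ?S"
    then obtain a' b' r' s' where q: "q = (a', b', r', s')" and e: "edge a' b' r' s'"
      and le: "2 * a \<le> a' + b'" "a' + b' \<le> 2 * a + 12" "0 \<le> r' + s'" "r' + s' \<le> 2"
      by (auto simp: sides_def)
    have "even a'" "a - 1 \<le> a'" "a' \<le> a + 6" using e le by (cases; simp)+
    then have "a' = a \<or> a' = a + 2 \<or> a' = a + 4 \<or> a' = a + 6"
      using assms by presburger
    then show "q \<in> ?L"
      using e le assms T_petal[of a] unfolding q by (elim disjE) (auto simp: edge.simps)
  qed
  show "?L \<subseteq> ?S"
    unfolding sides_def using assms T_petal[of a] by (auto simp: edge.simps)
qed

lemma card_sides:
  assumes "pent a b r s"
  shows "card (sides a b r s) = 5"
  using assms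
  by cases (auto simp: sides_outer_pent sides_middle_pent[simplified] sides_spoke_pent sides_petal)

lemma sides_within:
  assumes "pent a b r s" "(a', b', r', s') \<in> sides a b r s"
  shows "a \<le> a' \<and> b' \<le> b \<and> r \<le> r' \<and> s' \<le> s"
  using assms
  by cases (auto simp: sides_outer_pent sides_middle_pent[simplified] sides_spoke_pent sides_petal split: if_splits)

text \<open>The bound \<open>r < 3\<close> sets aside the outer arcs, whose second face is the
  exterior.\<close>

lemma edge_two_sides:
  assumes "edge a b r s" "r < 3"
  obtains a1 b1 r1 s1 a2 b2 r2 s2
  where "pent a1 b1 r1 s1" "a1 \<le> a" "b \<le> b1" "r1 \<le> r" "s \<le> s1"
    and "pent a2 b2 r2 s2" "a2 \<le> a" "b \<le> b2" "r2 \<le> r" "s \<le> s2"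
    and "(a1, b1, r1, s1) \<noteq> (a2, b2, r2, s2)"
proof -
  note two = that
  have column: "\<exists>r\<le>1. pent x (x + 2) r 2" if "even x" for x
  proof (cases "T x \<in> {Stop, Spoke}")
    case True
    then show ?thesis using that by (intro exI[of _ 0]) (simp add: spoke_pent)
  next
    case False
    then show ?thesis using that by (intro exI[of _ 1]) (simp add: middle_pent)
  qed
  have deep: "pent x (x + 2) 0 2" if "even x" "T x = Stop \<or> T x = Spoke" for x
    using spoke_pent[of x] that by auto
  from assms(1) show thesis
  proof cases
    case outer_arc
    then show thesis using assms by simp
  next
    case middle_arc
    show thesis
    proof (cases "even a")
      case True
      then obtain r1 where "pent a (a + 2) r1 2" "r1 \<le> 1" using column by blast
      then show thesis
        by (intro two[of a "a + 2" r1 2 "a - 1" "a + 1" 2 3]) (use middle_arc True outer_pent[of "a - 1"] in \<open>auto simp: algebra_simps\<close>)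
    next
      case False
      then obtain r1 where "pent (a - 1) (a + 1) r1 2" "r1 \<le> 1"
        using column[of "a - 1"] by (auto simp: algebra_simps)
      then show thesis
        by (intro two[of "a - 1" "a + 1" r1 2 a "a + 2" 2 3]) (use middle_arc False outer_pent[of a] in auto)
    qed
  next
    case inner_arc
    then consider "T a = Start" | "T a = Left" | "T a = Right" by (cases "T a") auto
    then have "\<exists>x. pent x (x + 6) 0 1 \<and> x \<le> a \<and> a \<le> x + 4"
    proof cases
      case 1
      then show ?thesis using petal[of a] inner_arc by (intro exI[of _ a]) auto
    next
      case 2
      then show ?thesis using petal[of "a - 2"] inner_arc T_prev(2)[of a] by (intro exI[of _ "a - 2"]) auto
    next
      case 3
      then show ?thesis using petal[of "a - 4"] inner_arc T_prev(3)[of a] T_prev(2)[of "a - 2"]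
        by (intro exI[of _ "a - 4"]) auto
    qed
    then obtain x where "pent x (x + 6) 0 1" "x \<le> a" "a \<le> x + 4" by blast
    then show thesis
      by (intro two[of a "a + 2" 1 2 x "x + 6" 0 1]) (use inner_arc middle_pent[of a] in auto)
  next
    case outer_ray
    then show thesis
      by (intro two[of a "a + 2" 2 3 "a - 2" a 2 3]) (use outer_pent[of a] outer_pent[of "a - 2"] in auto)
  next
    case inner_ray
    obtain r1 where "pent a (a + 2) r1 2" "r1 \<le> 1" using column inner_ray by blast
    moreover obtain r2 where "pent (a - 2) a r2 2" "r2 \<le> 1"
      using column[of "a - 2"] inner_ray by auto
    ultimately show thesis
      by (intro two[of a "a + 2" r1 2 "a - 2" a r2 2]) (use inner_ray in auto)
  next
    case spoke
    then show thesis
      by (intro two[of a "a + 2" 0 2 "a - 2" a 0 2]) (use deep[of a] deep[of "a - 2"] T_prev(5)[of a] in auto)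
  next
    case hub_ray
    have petal_before: "T (a - 2) = Right \<Longrightarrow> pent (a - 6) a 0 1"
      using petal[of "a - 6"] hub_ray T_prev(3)[of "a - 2"] T_prev(2)[of "a - 4"] by auto
    show thesis
    proof (cases "T a = Start")
      case True
      then have after: "pent a (a + 6) 0 1" using petal hub_ray by auto
      show thesis
      \<comment> \<open>A \<open>Start\<close> inside a fan is preceded by the previous petal;
        otherwise the slot before is \<open>Spoke\<close> and the neighbour is a spoke
        pentagon.\<close>
      proof (cases "T (a - 2) = Right")
        case True
        then show thesis
          by (intro two[of a "a + 6" 0 1 "a - 6" a 0 1]) (use hub_ray after petal_before in auto)
      next
        case False
        then show thesis
          by (intro two[of a "a + 6" 0 1 "a - 2" a 0 2])
            (use hub_ray after deep[of "a - 2"] T_prev(1)[OF True] in auto)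
      qed
    next
      case False
      then have "T a = Stop" using hub_ray by auto
      then show thesis
        by (intro two[of a "a + 2" 0 2 "a - 6" a 0 1])
          (use hub_ray deep[of a] petal_before T_prev(4)[of a] in auto)
    qed
  qed
qed

subsection \<open>Polar rectangles\<close>

definition pt :: "real \<Rightarrow> real \<Rightarrow> complex" where
  "pt x r = of_real r * cis (pi * x / n)"

definition sector :: "int \<Rightarrow> int \<Rightarrow> int \<Rightarrow> int \<Rightarrow> complex set" where
  "sector a b r s = (\<lambda>p. pt (fst p) (snd p)) ` ({real_of_int a..of_int b} \<times> {real_of_int r..of_int s})"

definition open_sector :: "int \<Rightarrow> int \<Rightarrow> int \<Rightarrow> int \<Rightarrow> complex set" where
  "open_sector a b r s = (\<lambda>p. pt (fst p) (snd p)) ` ({real_of_int a<..<of_int b} \<times> {real_of_int r<..<of_int s})"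

lemma n_pos: "0 < n"
  using n_ge by simp

lemma norm_pt [simp]: "cmod (pt x r) = \<bar>r\<bar>"
  by (simp add: pt_def norm_mult)

lemma pt_0 [simp]: "pt x 0 = 0"
  by (simp add: pt_def)

lemma pt_eq_0_iff [simp]: "pt x r = 0 \<longleftrightarrow> r = 0"
  by (simp add: pt_def)

lemma pt_surj: obtains x r where "0 \<le> r" "z = pt x r"
proof
  show "0 \<le> cmod z" by simp
  show "z = pt (Arg z * n / pi) (cmod z)"
    using rcis_cmod_Arg[of z] n_pos by (simp add: pt_def rcis_def)
qed

text \<open>The signs of the radii exclude the second polar form of a point, with negative radius
  and the angle turned by half.\<close>

lemma pt_eq_iff:
  fixes x x' r r' :: real
  assumes "0 < r" "0 \<le> r'"
  shows "pt x r = pt x' r' \<longleftrightarrow> r = r' \<and> (\<exists>m::int. x' = x + 2 * real n * of_int m)"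
proof -
  have "cis (pi * x / n) = cis (pi * x' / n) \<longleftrightarrow>
      sin (pi * x' / n) = sin (pi * x / n) \<and> cos (pi * x' / n) = cos (pi * x / n)"
    by (auto simp: complex_eq_iff)
  also have "\<dots> \<longleftrightarrow> (\<exists>m::int. pi * x' / n = pi * x / n + 2 * pi * m)"
    by (rule sin_cos_eq_iff)
  also have "\<dots> \<longleftrightarrow> (\<exists>m::int. x' = x + 2 * real n * of_int m)"
  proof (intro iff_exI)
    fix m :: int
    have "pi * x / n + 2 * pi * m = pi * (x + 2 * real n * of_int m) / n"
      using n_pos by (simp add: field_simps)
    then show "pi * x' / n = pi * x / n + 2 * pi * m \<longleftrightarrow> x' = x + 2 * real n * of_int m"
      using n_pos by simp
  qed
  finally have "cis (pi * x / n) = cis (pi * x' / n) \<longleftrightarrow> (\<exists>m::int. x' = x + 2 * real n * of_int m)" .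
  moreover have "r = r'" if "pt x r = pt x' r'"
    using arg_cong[OF that, of cmod] assms by simp
  ultimately show ?thesis
    using assms by (auto simp: pt_def)
qed

lemma pt_shift [simp]: "pt (x + 2 * real n * of_int m) r = pt x r"
proof -
  have "pi * (x + 2 * real n * of_int m) / n = pi * x / n + 2 * pi * of_int m"
    using n_pos by (simp add: field_simps)
  then show ?thesis
    by (simp add: pt_def cis_mult[symmetric] cis_multiple_2pi)
qed

lemma continuous_pt: "continuous_on A (\<lambda>p. pt (fst p) (snd p))"
  unfolding pt_def cis_conv_exp using n_pos by (intro continuous_intros) auto

lemma closed_sector: "closed (sector a b r s)"
  unfolding sector_def
  by (intro compact_imp_closed compact_continuous_image continuous_pt compact_Times compact_Icc)

text \<open>Compactness of the closed rectangle gives one inclusion, continuity of \<open>pt\<close>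
  the other; this also covers rectangles with a side collapsed to the hub.\<close>

lemma closure_open_sector:
  assumes "a < b" "r < s"
  shows "closure (open_sector a b r s) = sector a b r s"
proof
  have "open_sector a b r s \<subseteq> sector a b r s"
    unfolding sector_def open_sector_def by (intro image_mono) auto
  then show "closure (open_sector a b r s) \<subseteq> sector a b r s"
    by (intro closure_minimal closed_sector)
  have "sector a b r s = (\<lambda>p. pt (fst p) (snd p)) ` closure ({real_of_int a<..<of_int b} \<times> {real_of_int r<..<of_int s})"
    using assms by (simp add: sector_def closure_Times)
  also have "\<dots> \<subseteq> closure (open_sector a b r s)"
    unfolding open_sector_def by (intro image_closure_subset continuous_pt closed_closure closure_subset)
  finally show "sector a b r s \<subseteq> closure (open_sector a b r s)" .
qed

text \<open>Invariance of domain: \<open>pt\<close> is injective here, as the radii are positive and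
  the angles span at most one full turn.\<close>

lemma open_open_sector:
  assumes "b \<le> a + 2 * int n" "0 \<le> r"
  shows "open (open_sector a b r s)"
  unfolding open_sector_def
proof (rule invariance_of_domain_gen)
  show "inj_on (\<lambda>p. pt (fst p) (snd p)) ({real_of_int a<..<of_int b} \<times> {real_of_int r<..<of_int s})"
  proof (rule inj_onI)
    fix p q :: "real \<times> real"
    assume p: "p \<in> {real_of_int a<..<of_int b} \<times> {real_of_int r<..<of_int s}" and q: "q \<in> {real_of_int a<..<of_int b} \<times> {real_of_int r<..<of_int s}"
      and "pt (fst p) (snd p) = pt (fst q) (snd q)"
    moreover have "0 < snd p" "0 < snd q" using p q assms(2) by auto
    ultimately obtain m :: int where m: "fst q = fst p + 2 * real n * of_int m" and s: "snd p = snd q"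
      by (auto simp: pt_eq_iff)
    have ab: "real_of_int b \<le> real_of_int a + 2 * n"
      using assms(1) by linarith
    have "\<bar>2 * real n * m\<bar> < 2 * real n * 1"
      using m p q ab by auto
    then have "m = 0"
      using n_pos by (simp add: abs_mult)
    then show "p = q" using m s by (simp add: prod_eq_iff)
  qed
qed (auto intro!: continuous_pt open_Times)

lemma connected_open_sector: "Topological_Spaces.connected (open_sector a b r s)"
  unfolding open_sector_def
  by (intro connected_continuous_image continuous_pt connected_Times) auto

lemma open_sector_nonempty: "a < b \<Longrightarrow> r < s \<Longrightarrow> open_sector a b r s \<noteq> {}"
  by (simp add: open_sector_def)

text \<open>
  The value is \<open>2 x\<close> if \<open>x\<close> is an integer, and otherwise the odd number \<open>2 \<lfloor>x\<rfloor> + 1\<close>; comparing it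
  with even numbers locates \<open>x\<close> relative to all integers.
\<close>

definition code :: "real \<Rightarrow> int" where "code x = \<lfloor>x\<rfloor> + \<lceil>x\<rceil>"

lemma code_ge_iff: "2 * a \<le> code x \<longleftrightarrow> real_of_int a \<le> x"
proof -
  have "\<lfloor>x\<rfloor> \<le> \<lceil>x\<rceil>" "\<lceil>x\<rceil> \<le> \<lfloor>x\<rfloor> + 1" by linarith+
  then have "2 * a \<le> code x \<longleftrightarrow> a \<le> \<lfloor>x\<rfloor>" unfolding code_def by linarith
  then show ?thesis by (simp add: le_floor_iff)
qed

lemma code_le_iff: "code x \<le> 2 * a \<longleftrightarrow> x \<le> real_of_int a"
proof -
  have "\<lfloor>x\<rfloor> \<le> \<lceil>x\<rceil>" "\<lceil>x\<rceil> \<le> \<lfloor>x\<rfloor> + 1" by linarith+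
  then have "code x \<le> 2 * a \<longleftrightarrow> \<lceil>x\<rceil> \<le> a" unfolding code_def by linarith
  then show ?thesis by (simp add: ceiling_le_iff)
qed

lemma code_gt_iff: "2 * a < code x \<longleftrightarrow> real_of_int a < x"
  using code_le_iff[of x a] by linarith

lemma code_less_iff: "code x < 2 * a \<longleftrightarrow> x < real_of_int a"
  using code_ge_iff[of a x] by linarith

lemma code_of_int [simp]: "code (of_int k) = 2 * k"
  by (simp add: code_def)

lemma pt_in_sector_iff:
  fixes x y :: real
  assumes "0 < y" "0 \<le> r"
  shows "pt x y \<in> sector a b r s \<longleftrightarrow> r \<le> y \<and> y \<le> s \<and>
    (\<exists>m::int. a \<le> x + 2 * real n * of_int m \<and> x + 2 * real n * of_int m \<le> b)"
proof
  assume "pt x y \<in> sector a b r s"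
  then obtain x' y' :: real where "pt x y = pt x' y'" "a \<le> x'" "x' \<le> b" "r \<le> y'" "y' \<le> s"
    by (auto simp: sector_def)
  moreover then have "0 \<le> y'" using assms by linarith
  ultimately show "r \<le> y \<and> y \<le> s \<and>
      (\<exists>m::int. a \<le> x + 2 * real n * of_int m \<and> x + 2 * real n * of_int m \<le> b)"
    using assms pt_eq_iff[of y y' x x'] by auto
next
  assume "r \<le> y \<and> y \<le> s \<and> (\<exists>m::int. a \<le> x + 2 * real n * of_int m \<and> x + 2 * real n * of_int m \<le> b)"
  then obtain m :: int where "r \<le> y" "y \<le> s" "a \<le> x + 2 * real n * of_int m" "x + 2 * real n * of_int m \<le> b"
    by blast
  then show "pt x y \<in> sector a b r s"
    unfolding sector_def by (intro image_eqI[of _ _ "(x + 2 * real n * of_int m, y)"]) auto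
qed

lemma pt_in_open_sector_iff:
  fixes x y :: real
  assumes "0 < y" "0 \<le> r"
  shows "pt x y \<in> open_sector a b r s \<longleftrightarrow> r < y \<and> y < s \<and>
    (\<exists>m::int. a < x + 2 * real n * of_int m \<and> x + 2 * real n * of_int m < b)"
proof
  assume "pt x y \<in> open_sector a b r s"
  then obtain x' y' :: real where "pt x y = pt x' y'" "a < x'" "x' < b" "r < y'" "y' < s"
    by (auto simp: open_sector_def)
  moreover then have "0 \<le> y'" using assms by linarith
  ultimately show "r < y \<and> y < s \<and>
      (\<exists>m::int. a < x + 2 * real n * of_int m \<and> x + 2 * real n * of_int m < b)"
    using assms pt_eq_iff[of y y' x x'] by auto
next
  assume "r < y \<and> y < s \<and> (\<exists>m::int. a < x + 2 * real n * of_int m \<and> x + 2 * real n * of_int m < b)"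
  then obtain m :: int where "r < y" "y < s" "a < x + 2 * real n * of_int m" "x + 2 * real n * of_int m < b"
    by blast
  then show "pt x y \<in> open_sector a b r s"
    unfolding open_sector_def by (intro image_eqI[of _ _ "(x + 2 * real n * of_int m, y)"]) auto
qed

section \<open>Invariance under full turns\<close>

lemma sector_shift: "sector (a + 2 * int n * m) (b + 2 * int n * m) r s = sector a b r s" (is "?L = ?R")
proof
  show "?L \<subseteq> ?R"
  proof
    fix z assume "z \<in> ?L"
    then obtain x y :: real where "z = pt x y" "a + 2 * int n * m \<le> x" "x \<le> b + 2 * int n * m" "r \<le> y" "y \<le> s"
      by (auto simp: sector_def)
    then show "z \<in> ?R"
      using pt_shift[of x "- m" y] unfolding sector_def
      by (intro image_eqI[of _ _ "(x - 2 * real n * of_int m, y)"]) auto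
  qed
  show "?R \<subseteq> ?L"
  proof
    fix z assume "z \<in> ?R"
    then obtain x y :: real where "z = pt x y" "a \<le> x" "x \<le> b" "r \<le> y" "y \<le> s"
      by (auto simp: sector_def)
    then show "z \<in> ?L"
      unfolding sector_def by (intro image_eqI[of _ _ "(x + 2 * real n * of_int m, y)"]) auto
  qed
qed

lemma open_sector_shift: "open_sector (a + 2 * int n * m) (b + 2 * int n * m) r s = open_sector a b r s" (is "?L = ?R")
proof
  show "?L \<subseteq> ?R"
  proof
    fix z assume "z \<in> ?L"
    then obtain x y :: real where "z = pt x y" "a + 2 * int n * m < x" "x < b + 2 * int n * m" "r < y" "y < s"
      by (auto simp: open_sector_def)
    then show "z \<in> ?R"
      using pt_shift[of x "- m" y] unfolding open_sector_def
      by (intro image_eqI[of _ _ "(x - 2 * real n * of_int m, y)"]) auto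
  qed
  show "?R \<subseteq> ?L"
  proof
    fix z assume "z \<in> ?R"
    then obtain x y :: real where "z = pt x y" "a < x" "x < b" "r < y" "y < s"
      by (auto simp: open_sector_def)
    then show "z \<in> ?L"
      unfolding open_sector_def by (intro image_eqI[of _ _ "(x + 2 * real n * of_int m, y)"]) auto
  qed
qed

text \<open>Supplies \<open>plus_of_int\<close>: invariance of \<open>t\<close> under all integer
  multiples of \<open>n\<close>.\<close>

sublocale periodic_fun_simple t "int n"
  by unfold_locales (rule t_periodic)

lemma T_shift [simp]: "T (a + 2 * int n * m) = T a"
proof -
  have "(a + 2 * int n * m) div 2 = a div 2 + m * int n"
    by (simp add: mult.commute mult.assoc)
  then show ?thesis
    using plus_of_int[of "a div 2" m] by (simp add: T_def)
qed

lemma vtx_shift: "vtx x r \<Longrightarrow> vtx (x + 2 * int n * m) r"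
  by (auto elim!: vtx.cases intro!: vtx.intros)

lemma edge_shift: "edge a b r s \<Longrightarrow> edge (a + 2 * int n * m) (b + 2 * int n * m) r s"
  by (erule edge.cases) (auto simp: edge.simps)

lemma pent_shift: "pent a b r s \<Longrightarrow> pent (a + 2 * int n * m) (b + 2 * int n * m) r s"
  by (erule pent.cases) (auto simp: pent.simps)

subsection \<open>The plane graph\<close>

definition vertices :: "complex set" where
  "vertices = {pt (of_int x) (of_int r) | x r. vtx x r}"

definition edges :: "complex set set" where
  "edges = {sector a b r s | a b r s. edge a b r s}"

definition pentagons :: "complex set set" where
  "pentagons = {open_sector a b r s | a b r s. pent a b r s}"

definition exterior :: "complex set" where
  "exterior = {z. 3 < cmod z}"

lemma edge_bounds:
  assumes "edge a b r s"
  shows "0 \<le> r" "r \<le> s" "s \<le> 3" "1 \<le> s" "a \<le> b" "b \<le> a + 2"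
    "a < b \<and> r = s \<or> a = b \<and> r < s"
  using assms by (auto elim!: edge.cases)

lemma pent_bounds:
  assumes "pent a b r s"
  shows "0 \<le> r" "r < s" "s \<le> 3" "a < b" "b \<le> a + 6"
  using assms by (auto elim!: pent.cases)

lemma vtx_bounds:
  assumes "vtx x r"
  shows "0 \<le> r" "r \<le> 3"
  using assms by (auto elim!: vtx.cases)

lemma vtx_ends:
  assumes "edge a b r s"
  shows "vtx a r" "vtx b s"
  using assms T_step[of a] by (auto elim!: edge.cases intro: vtx.intros simp: vtx.simps)

lemma code_eq_iff: "code x = 2 * k \<longleftrightarrow> x = of_int k"
  using code_ge_iff[of k x] code_le_iff[of x k] by linarith

lemma code_pos: "0 < y \<Longrightarrow> 0 < code y"
  using code_gt_iff[of 0 y] by simp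

text \<open>The bridge from points to integers: among the shifted copies of an edge, the one over
  the given \<open>x\<close> is chosen, so that all edges through a point can be compared at the
  same \<open>(code x, code y)\<close>.\<close>

lemma in_edgesE:
  assumes "e \<in> edges" "pt x y \<in> e" "0 < y"
  obtains a b r s where "edge a b r s" "e = sector a b r s"
    "2 * a \<le> code x" "code x \<le> 2 * b" "2 * r \<le> code y" "code y \<le> 2 * s"
proof -
  obtain a b r s where e: "edge a b r s" "e = sector a b r s"
    using assms(1) by (auto simp: edges_def)
  then obtain m :: int where "r \<le> y" "y \<le> s" "a \<le> x + 2 * real n * of_int m" "x + 2 * real n * of_int m \<le> b"
    using pt_in_sector_iff[of y r x a b s] assms edge_bounds[OF e(1)] by auto
  then show thesis
    using e edge_shift[of a b r s "- m"] sector_shift[of a "- m" b r s]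
      code_ge_iff[of "a - 2 * int n * m" x] code_le_iff[of x "b - 2 * int n * m"]
    by (intro that[of "a - 2 * int n * m" "b - 2 * int n * m" r s]) (auto simp: code_ge_iff code_le_iff)
qed

lemma in_pentagonsE:
  assumes "F \<in> pentagons" "pt x y \<in> F" "0 < y"
  obtains a b r s where "pent a b r s" "F = open_sector a b r s"
    "2 * a < code x" "code x < 2 * b" "2 * r < code y" "code y < 2 * s"
proof -
  obtain a b r s where e: "pent a b r s" "F = open_sector a b r s"
    using assms(1) by (auto simp: pentagons_def)
  then obtain m :: int where "r < y" "y < s" "a < x + 2 * real n * of_int m" "x + 2 * real n * of_int m < b"
    using pt_in_open_sector_iff[of y r x a b s] assms pent_bounds[OF e(1)] by auto
  then show thesis
    using e pent_shift[of a b r s "- m"] open_sector_shift[of a "- m" b r s]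
      code_gt_iff[of "a - 2 * int n * m" x] code_less_iff[of x "b - 2 * int n * m"]
    by (intro that[of "a - 2 * int n * m" "b - 2 * int n * m" r s]) (auto simp: code_gt_iff code_less_iff)
qed

lemma pt_in_sectorI:
  "2 * a \<le> code x \<Longrightarrow> code x \<le> 2 * b \<Longrightarrow> 2 * r \<le> code y \<Longrightarrow> code y \<le> 2 * s \<Longrightarrow> pt x y \<in> sector a b r s"
  unfolding sector_def by (intro image_eqI[of _ _ "(x, y)"]) (auto simp: code_ge_iff code_le_iff)

lemma pt_in_open_sectorI:
  "2 * a < code x \<Longrightarrow> code x < 2 * b \<Longrightarrow> 2 * r < code y \<Longrightarrow> code y < 2 * s \<Longrightarrow> pt x y \<in> open_sector a b r s"
  unfolding open_sector_def by (intro image_eqI[of _ _ "(x, y)"]) (auto simp: code_gt_iff code_less_iff)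

lemma in_verticesE:
  assumes "pt x y \<in> vertices" "0 < y"
  obtains k j where "vtx k j" "x = of_int k" "y = of_int j"
proof -
  obtain k j where kj: "vtx k j" "pt x y = pt (of_int k) (of_int j)"
    using assms(1) by (auto simp: vertices_def)
  then obtain m :: int where "y = of_int j" "real_of_int k = x + 2 * real n * of_int m"
    using pt_eq_iff[OF assms(2), of "of_int j" x "of_int k"] vtx_bounds(1)[OF kj(1)] by auto
  then show thesis
    using kj vtx_shift[of k j "- m"] by (intro that[of "k - 2 * int n * m" j]) auto
qed

lemma vertexI: "vtx x r \<Longrightarrow> pt (of_int x) (of_int r) \<in> vertices"
  by (auto simp: vertices_def)

lemma zero_in_vertices: "0 \<in> vertices"
  using vertexI[OF hub] by simp

lemma zero_notin_pentagon: "F \<in> pentagons \<Longrightarrow> 0 \<notin> F"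
  by (auto simp: pentagons_def open_sector_def dest!: pent_bounds(1))

lemma edge_inter_subset_vertices:
  assumes "e \<in> edges" "e' \<in> edges" "e \<noteq> e'"
  shows "e \<inter> e' \<subseteq> vertices"
proof
  fix z assume z: "z \<in> e \<inter> e'"
  obtain x y where xy: "0 \<le> y" "z = pt x y" using pt_surj .
  show "z \<in> vertices"
  proof (cases "y = 0")
    case True
    then show ?thesis using xy zero_in_vertices by simp
  next
    case False
    then have y: "0 < y" using xy by simp
    obtain a b r s where e: "edge a b r s" "e = sector a b r s"
      "2 * a \<le> code x" "code x \<le> 2 * b" "2 * r \<le> code y" "code y \<le> 2 * s"
      using in_edgesE[OF assms(1) _ y] z xy by blast
    obtain a' b' r' s' where e': "edge a' b' r' s'" "e' = sector a' b' r' s'"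
      "2 * a' \<le> code x" "code x \<le> 2 * b'" "2 * r' \<le> code y" "code y \<le> 2 * s'"
      using in_edgesE[OF assms(2) _ y] z xy by blast
    show ?thesis
    proof (rule ccontr)
      assume "z \<notin> vertices"
      then have "(code x, code y) \<noteq> (2 * k, 2 * j)" if "vtx k j" for k j
        using vertexI[OF that] xy by (auto simp: code_eq_iff)
      then have "(a, b, r, s) = (a', b', r', s')"
        using edge_unique[OF e(1) e(3-6) e'(1) e'(3-6) code_pos[OF y]] by blast
      then show False using assms(3) e(2) e'(2) by simp
    qed
  qed
qed

lemma edge_inter_vertices:
  assumes "edge a b r s"
  shows "sector a b r s \<inter> vertices = {pt (of_int a) (of_int r), pt (of_int b) (of_int s)}"
proof
  have "pt (of_int a) (of_int r) \<in> sector a b r s" "pt (of_int b) (of_int s) \<in> sector a b r s"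
    using edge_bounds[OF assms] by (auto intro: pt_in_sectorI)
  then show "{pt (of_int a) (of_int r), pt (of_int b) (of_int s)} \<subseteq> sector a b r s \<inter> vertices"
    using vertexI vtx_ends[OF assms] by auto
  show "sector a b r s \<inter> vertices \<subseteq> {pt (of_int a) (of_int r), pt (of_int b) (of_int s)}"
  proof
    fix z assume z: "z \<in> sector a b r s \<inter> vertices"
    then obtain x y :: real where xy: "z = pt x y" "a \<le> x" "x \<le> b" "r \<le> y" "y \<le> s"
      by (auto simp: sector_def)
    show "z \<in> {pt (of_int a) (of_int r), pt (of_int b) (of_int s)}"
    proof (cases "y = 0")
      case True
      then have "r = 0" using xy edge_bounds[OF assms] by auto
      then show ?thesis using True xy by simp
    next
      case False
      then have y: "0 < y" using xy edge_bounds(1)[OF assms] by linarith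
      then obtain k j where "vtx k j" "x = of_int k" "y = of_int j"
        using in_verticesE z xy by blast
      then have "(k, j) = (a, r) \<or> (k, j) = (b, s)"
        using edge_vertex[OF assms, of k j] xy y by auto
      then show ?thesis using xy \<open>x = _\<close> \<open>y = _\<close> by auto
    qed
  qed
qed

text \<open>On a radial edge the angle is constant, so the collapse at the hub does no harm; on an
  arc the radius is positive and the width at most 2.\<close>

lemma inj_on_pt_edge:
  assumes "edge a b r s"
  shows "inj_on (\<lambda>p. pt (fst p) (snd p)) ({real_of_int a..of_int b} \<times> {real_of_int r..of_int s})"
proof (rule inj_onI)
  fix p q :: "real \<times> real"
  assume p: "p \<in> {real_of_int a..of_int b} \<times> {real_of_int r..of_int s}"
    and q: "q \<in> {real_of_int a..of_int b} \<times> {real_of_int r..of_int s}"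
    and eq: "pt (fst p) (snd p) = pt (fst q) (snd q)"
  note bounds = edge_bounds[OF assms]
  have nonneg: "0 \<le> snd p" "0 \<le> snd q"
    using p q bounds(1) by (auto intro: order_trans[of _ "real_of_int r"])
  then have s: "snd p = snd q"
    using arg_cong[OF eq, of cmod] by simp
  have "fst p = fst q"
  proof (cases "a = b")
    case True
    then show ?thesis using p q by auto
  next
    case False
    then have "0 < snd p"
      using bounds p by auto
    then obtain m :: int where m: "fst q = fst p + 2 * real n * of_int m"
      using eq nonneg by (auto simp: pt_eq_iff)
    have "real_of_int b < real_of_int a + 2 * n"
      using bounds(6) n_ge by linarith
    then have "\<bar>2 * real n * of_int m\<bar> < 2 * real n * 1"
      using m p q by auto
    then have "m = 0"
      using n_pos by (simp add: abs_mult)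
    then show ?thesis using m by simp
  qed
  with s show "p = q" by (simp add: prod_eq_iff)
qed

lemma closed_segment_axis:
  fixes a b r s :: real
  assumes "a = b \<or> r = s" "a \<le> b" "r \<le> s"
  shows "closed_segment (a, r) (b, s) = {a..b} \<times> {r..s}"
  using assms
proof (elim disjE)
  assume "a = b"
  then show ?thesis
    using assms by (simp add: closed_segment_same_fst closed_segment_eq_real_ivl)
next
  assume "r = s"
  then show ?thesis
    using assms by (simp add: closed_segment_same_snd closed_segment_eq_real_ivl)
qed

lemma edge_arc:
  assumes "edge a b r s"
  obtains g where "arc g" "path_image g = sector a b r s"
    "pathstart g = pt (of_int a) (of_int r)" "pathfinish g = pt (of_int b) (of_int s)"
proof
  define l where "l = linepath (real_of_int a, real_of_int r) (real_of_int b, real_of_int s)"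
  let ?g = "(\<lambda>p. pt (fst p) (snd p)) \<circ> l"
  have seg: "path_image l = {real_of_int a..of_int b} \<times> {real_of_int r..of_int s}"
    using edge_bounds[OF assms] unfolding l_def path_image_linepath
    by (intro closed_segment_axis) auto
  show "path_image ?g = sector a b r s"
    by (simp add: path_image_compose seg sector_def)
  show "pathstart ?g = pt (of_int a) (of_int r)" "pathfinish ?g = pt (of_int b) (of_int s)"
    by (simp_all add: pathstart_compose pathfinish_compose l_def)
  have "arc l"
    using edge_bounds(7)[OF assms] unfolding l_def by (intro arc_linepath) auto
  then show "arc ?g"
    using inj_on_pt_edge[OF assms] unfolding arc_def seg[symmetric] path_image_def
    by (auto intro: comp_inj_on path_continuous_image continuous_pt)
qed

text \<open>This makes the graph simple. Equal ends fix angles only up to full turns, but edges are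
  so short that the shifts at both ends agree.\<close>

lemma edge_ends_unique:
  assumes "edge a b r s" "edge a' b' r' s'"
    and ends: "sector a b r s \<inter> vertices = sector a' b' r' s' \<inter> vertices"
  shows "sector a b r s = sector a' b' r' s'"
proof -
  note bounds = edge_bounds[OF assms(1)] edge_bounds[OF assms(2)]
  have shifted: "j = j' \<and> (\<exists>m. k' = k + 2 * int n * m)"
    if eq: "pt (real_of_int k) (real_of_int j) = pt (real_of_int k') (real_of_int j')" and pos: "0 < j" "0 \<le> j'" for k j k' j'
  proof -
    obtain m :: int where "real_of_int j = real_of_int j'" "real_of_int k' = real_of_int k + 2 * real n * real_of_int m"
      using eq pos pt_eq_iff[of "of_int j" "of_int j'" "of_int k" "of_int k'"] by auto
    then have "j = j'" "real_of_int k' = real_of_int (k + 2 * int n * m)" by auto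
    then show ?thesis by (metis of_int_eq_iff)
  qed
  have eq: "{pt (of_int a) (of_int r), pt (of_int b) (of_int s)} =
      {pt (of_int a') (of_int r'), pt (of_int b') (of_int s')}"
    using ends edge_inter_vertices assms(1,2) by simp
  then consider "pt (of_int a) (of_int r) = pt (of_int a') (of_int r')"
      "pt (of_int b) (of_int s) = pt (of_int b') (of_int s')"
    | "pt (of_int a) (of_int r) = pt (of_int b') (of_int s')"
      "pt (of_int b) (of_int s) = pt (of_int a') (of_int r')"
    by (auto simp: doubleton_eq_iff)
  then show ?thesis
  proof cases
    case 1
    obtain m where m: "s = s'" "b' = b + 2 * int n * m"
      using shifted[OF 1(2)] bounds by auto
    have r: "r = r'"
      using arg_cong[OF 1(1), of cmod] bounds by simp
    have "a' = a + 2 * int n * m"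
    proof (cases "r < s")
      case True
      then show ?thesis using bounds m r by auto
    next
      case False
      then have "0 < r" using bounds by auto
      then obtain m' where m': "a' = a + 2 * int n * m'"
        using shifted[OF 1(1)] bounds by auto
      have "2 * int n * (m - m') = (b' - a') - (b - a)"
        using m m' by (simp add: algebra_simps)
      then have "\<bar>2 * int n * (m - m')\<bar> < 2 * int n * 1"
        using bounds n_ge by linarith
      then have "m = m'" using n_pos by (simp add: abs_mult)
      then show ?thesis using m' by simp
    qed
    then show ?thesis using m r sector_shift[of a m b r s] by simp
  next
    \<comment> \<open>Swapped ends force two arcs. Their lengths would add up to a multiple of a
      full turn, although the sum is between 2 and 4.\<close>
    case 2
    have "s' = r" "s = r'"
      using arg_cong[OF 2(1), of cmod] arg_cong[OF 2(2), of cmod] bounds by simp_all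
    then have flat: "r = s" "r' = s'" "r = r'" "0 < r" "a < b" "a' < b'" using bounds by auto
    obtain m where m: "b' = a + 2 * int n * m"
      using shifted[OF 2(1)] bounds flat by auto
    obtain m' where m': "a' = b + 2 * int n * m'"
      using shifted[OF 2(2)] bounds flat by auto
    have sum: "2 * int n * (m - m') = (b' - a') + (b - a)"
      using m m' by (simp add: algebra_simps)
    then have "\<bar>2 * int n * (m - m')\<bar> < 2 * int n * 1"
      using bounds n_ge by linarith
    then have "m = m'" using n_pos by (simp add: abs_mult)
    then show ?thesis using sum flat by simp
  qed
qed

lemma inj_on_edge_ends: "inj_on (\<lambda>e. e \<inter> vertices) edges"
proof (rule inj_onI)
  fix e e' assume "e \<in> edges" "e' \<in> edges" and eq: "e \<inter> vertices = e' \<inter> vertices"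
  then obtain a b r s a' b' r' s' where "edge a b r s" "e = sector a b r s"
    and "edge a' b' r' s'" "e' = sector a' b' r' s'"
    unfolding edges_def mem_Collect_eq by (elim exE conjE) (rule that)
  then show "e = e'"
    using eq edge_ends_unique[of a b r s a' b' r' s'] by simp
qed

lemma finite_vertices: "finite vertices"
proof -
  have "vertices \<subseteq> (\<lambda>(x, r). pt (of_int x) (of_int r)) ` ({0..<2 * int n} \<times> {0..3})"
  proof
    fix z assume "z \<in> vertices"
    then obtain x r where z: "z = pt (of_int x) (of_int r)" "vtx x r" by (auto simp: vertices_def)
    define k m where "k = x mod (2 * int n)" and "m = x div (2 * int n)"
    have "x = k + 2 * int n * m"
      by (simp only: k_def m_def mod_mult_div_eq)
    then have "z = pt (of_int k) (of_int r)"
      using z by simp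
    then show "z \<in> (\<lambda>(x, r). pt (of_int x) (of_int r)) ` ({0..<2 * int n} \<times> {0..3})"
      using vtx_bounds[OF z(2)] n_pos by (intro image_eqI[of _ _ "(k, r)"]) (auto simp: k_def)
  qed
  then show ?thesis by (rule finite_subset) auto
qed

lemma finite_edges: "finite edges"
proof -
  have "(\<lambda>e. e \<inter> vertices) ` edges \<subseteq> Pow vertices" by auto
  then show ?thesis
    using finite_vertices inj_on_edge_ends by (meson finite_Pow_iff inj_on_finite)
qed

lemma plane_graph: "plane_graph vertices edges"
  unfolding plane_graph_def
proof (intro conjI ballI impI)
  show "finite vertices" "finite edges" by (rule finite_vertices finite_edges)+
next
  fix e assume "e \<in> edges"
  then obtain a b r s where e: "edge a b r s" "e = sector a b r s" by (auto simp: edges_def)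
  then show "\<exists>g. arc g \<and> path_image g = e \<and> e \<inter> vertices = {pathstart g, pathfinish g}"
    using edge_arc[OF e(1)] edge_inter_vertices[OF e(1)] by metis
next
  fix e e' assume "e \<in> edges" "e' \<in> edges" "e \<noteq> e'"
  then show "e \<inter> vertices \<noteq> e' \<inter> vertices" "e \<inter> e' \<subseteq> vertices"
    by (simp_all add: inj_on_eq_iff[OF inj_on_edge_ends] edge_inter_subset_vertices)
qed

subsection \<open>Faces\<close>

lemma norm_less_pentagon:
  assumes "F \<in> pentagons" "z \<in> F"
  shows "cmod z < 3"
proof -
  obtain a b r s where "pent a b r s" "F = open_sector a b r s"
    using assms(1) by (auto simp: pentagons_def)
  moreover then obtain x y :: real where "z = pt x y" "r < y" "y < s"
    using assms(2) by (auto simp: open_sector_def)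
  ultimately show ?thesis
    using pent_bounds[of a b r s] by auto
qed

lemma norm_edge:
  assumes "edge a b r s" "z \<in> sector a b r s"
  shows "r \<le> cmod z" "cmod z \<le> s"
proof -
  obtain x y :: real where "z = pt x y" "r \<le> y" "y \<le> s"
    using assms(2) by (auto simp: sector_def)
  then show "r \<le> cmod z" "cmod z \<le> s"
    using edge_bounds(1)[OF assms(1)] by auto
qed

lemma pt_surj_pos:
  assumes "z \<noteq> 0"
  obtains x y where "0 < y" "z = pt x y"
  using assms pt_surj[of z] by (metis less_eq_real_def pt_eq_0_iff)

lemma pentagons_disjoint:
  assumes "F \<in> pentagons" "F' \<in> pentagons" "F \<noteq> F'"
  shows "F \<inter> F' = {}"
proof (rule ccontr)
  assume "F \<inter> F' \<noteq> {}"
  then obtain z where z: "z \<in> F" "z \<in> F'" by blast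
  then have "z \<noteq> 0" using zero_notin_pentagon[OF assms(1)] by blast
  then obtain x y where y: "0 < y" and xy: "z = pt x y" by (rule pt_surj_pos)
  obtain a b r s where F: "pent a b r s" "F = open_sector a b r s"
    "2 * a < code x" "code x < 2 * b" "2 * r < code y" "code y < 2 * s"
    using in_pentagonsE[OF assms(1) _ y] z xy by blast
  obtain a' b' r' s' where F': "pent a' b' r' s'" "F' = open_sector a' b' r' s'"
    "2 * a' < code x" "code x < 2 * b'" "2 * r' < code y" "code y < 2 * s'"
    using in_pentagonsE[OF assms(2) _ y] z xy by blast
  show False
    using pent_unique[OF F(1) F(3-6) F'(1) F'(3-6)] assms(3) F(2) F'(2) by simp
qed

lemma pentagon_disjoint_graph:
  assumes "F \<in> pentagons" "z \<in> F"
  shows "z \<notin> vertices" "e \<in> edges \<Longrightarrow> z \<notin> e"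
proof -
  have "z \<noteq> 0" using zero_notin_pentagon assms by metis
  then obtain x y where y: "0 < y" and xy: "z = pt x y" by (rule pt_surj_pos)
  obtain a b r s where F: "pent a b r s" "F = open_sector a b r s"
    "2 * a < code x" "code x < 2 * b" "2 * r < code y" "code y < 2 * s"
    using in_pentagonsE[OF assms(1) _ y] assms(2) xy by metis
  show "z \<notin> vertices"
  proof
    assume "z \<in> vertices"
    then obtain k j where "vtx k j" "x = of_int k" "y = of_int j"
      using in_verticesE[OF _ y] xy by metis
    then show False using pent_no_vertex[OF F(1), of k j] F by simp
  qed
  show "z \<notin> e" if e: "e \<in> edges"
  proof
    assume "z \<in> e"
    then obtain a' b' r' s' where "edge a' b' r' s'" "e = sector a' b' r' s'"
      "2 * a' \<le> code x" "code x \<le> 2 * b'" "2 * r' \<le> code y" "code y \<le> 2 * s'"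
      using in_edgesE[OF e _ y] xy by metis
    then show False using pent_no_edge[OF F(1) F(3-6)] code_pos[OF y] by metis
  qed
qed

lemma exterior_disjoint_graph:
  assumes "z \<in> exterior"
  shows "z \<notin> vertices" "e \<in> edges \<Longrightarrow> z \<notin> e"
proof -
  show "z \<notin> vertices"
  proof
    assume "z \<in> vertices"
    then obtain x r where "z = pt (of_int x) (of_int r)" "vtx x r" by (auto simp: vertices_def)
    then show False using assms vtx_bounds[of x r] by (auto simp: exterior_def)
  qed
  show "z \<notin> e" if e: "e \<in> edges"
  proof
    assume "z \<in> e"
    moreover obtain a b r s where "edge a b r s" "e = sector a b r s"
      using e by (auto simp: edges_def)
    ultimately show False
      using assms norm_edge(2)[of a b r s z] edge_bounds(3)[of a b r s] by (simp add: exterior_def)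
  qed
qed

lemma face_cover: "\<Union>(insert exterior pentagons) = - (vertices \<union> \<Union>edges)"
proof
  show "\<Union>(insert exterior pentagons) \<subseteq> - (vertices \<union> \<Union>edges)"
  proof
    fix z assume "z \<in> \<Union>(insert exterior pentagons)"
    then consider "z \<in> exterior" | F where "F \<in> pentagons" "z \<in> F" by blast
    then show "z \<in> - (vertices \<union> \<Union>edges)"
      by cases (auto dest: pentagon_disjoint_graph exterior_disjoint_graph)
  qed
  show "- (vertices \<union> \<Union>edges) \<subseteq> \<Union>(insert exterior pentagons)"
  proof
    fix z assume z: "z \<in> - (vertices \<union> \<Union>edges)"
    then have "z \<noteq> 0" using zero_in_vertices by blast
    then obtain x y where y: "0 < y" and xy: "z = pt x y" by (rule pt_surj_pos)
    show "z \<in> \<Union>(insert exterior pentagons)"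
    proof (cases "3 < y")
      case True
      then show ?thesis using xy by (simp add: exterior_def)
    next
      case False
      then have "code y \<le> 6" using code_le_iff[of y 3] by simp
      then show ?thesis
      proof (rule edge_or_pent[OF code_pos[OF y]])
        fix a b r s
        assume "edge a b r s" "2 * a \<le> code x" "code x \<le> 2 * b" "2 * r \<le> code y" "code y \<le> 2 * s"
        then have "z \<in> sector a b r s" "sector a b r s \<in> edges"
          unfolding xy edges_def by (auto intro: pt_in_sectorI)
        then show ?thesis using z by blast
      next
        fix a b r s
        assume "pent a b r s" "2 * a < code x" "code x < 2 * b" "2 * r < code y" "code y < 2 * s"
        then have "z \<in> open_sector a b r s" "open_sector a b r s \<in> pentagons"
          unfolding xy pentagons_def by (auto intro: pt_in_open_sectorI)
        then show ?thesis by blast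
      qed
    qed
  qed
qed

lemma exterior_eq: "exterior = - cball 0 3"
  by (auto simp: exterior_def)

lemma face_open_connected:
  assumes "F \<in> insert exterior pentagons"
  shows "open F \<and> Topological_Spaces.connected F \<and> F \<noteq> {}"
proof -
  from assms consider "F = exterior" | "F \<in> pentagons" by blast
  then show ?thesis
  proof cases
    case 1
    have "Topological_Spaces.connected exterior"
      unfolding exterior_eq by (rule connected_complement_bounded_convex) auto
    moreover have "of_real 4 \<in> exterior"
      unfolding exterior_def mem_Collect_eq norm_of_real by simp
    moreover have "open exterior"
      unfolding exterior_eq by (intro open_Compl closed_cball)
    ultimately show ?thesis
      using 1 by blast
  next
    case 2
    then obtain a b r s where p: "pent a b r s" "F = open_sector a b r s"
      by (auto simp: pentagons_def)
    then have "b \<le> a + 2 * int n" using pent_bounds(5)[OF p(1)] n_ge by linarith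
    then show ?thesis
      using p pent_bounds[OF p(1)] by (simp add: open_open_sector connected_open_sector open_sector_nonempty)
  qed
qed

lemma exterior_disjoint_pentagon:
  assumes "F \<in> pentagons"
  shows "exterior \<inter> F = {}"
  using norm_less_pentagon[OF assms] by (force simp: exterior_def)

text \<open>Disjoint, nonempty, connected open sets that fill the complement of the graph must be
  its components.\<close>

lemma plane_faces: "plane_faces vertices edges = insert exterior pentagons"
  unfolding plane_faces_def
proof (rule components_open_unique)
  show "pairwise disjnt (insert exterior pentagons)"
    using pentagons_disjoint exterior_disjoint_pentagon
    by (auto simp: pairwise_insert pairwise_def disjnt_def Int_commute)
qed (rule face_cover, rule face_open_connected)

text \<open>A face is open and misses every edge; the closure is easier to handle, since for a
  pentagon it is the closed rectangle.\<close>

lemma subset_frontier_iff: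
  assumes "F \<in> plane_faces vertices edges" "e \<in> edges"
  shows "e \<subseteq> frontier F \<longleftrightarrow> e \<subseteq> closure F"
proof -
  have "open F"
    using assms(1) face_open_connected by (simp add: plane_faces)
  moreover have "e \<inter> F = {}"
    using assms(1) pentagon_disjoint_graph(2)[OF _ _ assms(2)] exterior_disjoint_graph(2)[OF _ assms(2)]
    unfolding plane_faces by blast
  ultimately show ?thesis
    by (auto simp: frontier_def interior_open)
qed

section \<open>The edges on the frontier of a pentagon\<close>

text \<open>The inclusion is evaluated at a single point, the midpoint, where it turns into the
  integer test that defines \<open>sides\<close>, up to a shift by \<open>m\<close> full
  turns.\<close>

lemma midpoint_in_sector:
  assumes "edge a b r s" "sector a b r s \<subseteq> sector a' b' r' s'" "0 \<le> r'"
  obtains m where "2 * a' \<le> a + b + 4 * int n * m" "a + b + 4 * int n * m \<le> 2 * b'"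
    "2 * r' \<le> r + s" "r + s \<le> 2 * s'"
proof -
  note bounds = edge_bounds[OF assms(1)]
  let ?x = "(a + b) / 2 :: real" and ?y = "(r + s) / 2 :: real"
  have "pt ?x ?y \<in> sector a b r s"
    unfolding sector_def using bounds by (intro image_eqI[of _ _ "(?x, ?y)"]) auto
  then have "pt ?x ?y \<in> sector a' b' r' s'" using assms(2) by blast
  moreover have "0 < ?y" using bounds by auto
  ultimately obtain m :: int where m: "r' \<le> ?y" "?y \<le> s'" "a' \<le> ?x + 2 * real n * of_int m"
      "?x + 2 * real n * of_int m \<le> b'"
    using pt_in_sector_iff assms(3) by blast
  have "real_of_int (2 * a') \<le> real_of_int (a + b + 4 * int n * m)"
    "real_of_int (a + b + 4 * int n * m) \<le> real_of_int (2 * b')"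
    "real_of_int (2 * r') \<le> real_of_int (r + s)" "real_of_int (r + s) \<le> real_of_int (2 * s')"
    using m by (simp_all add: field_simps)
  then show thesis
    unfolding of_int_le_iff by (rule that)
qed

lemma sector_mono:
  "a' \<le> a \<Longrightarrow> b \<le> b' \<Longrightarrow> r' \<le> r \<Longrightarrow> s \<le> s' \<Longrightarrow> sector a b r s \<subseteq> sector a' b' r' s'"
  unfolding sector_def by (intro image_mono) auto

lemma closure_pentagon:
  assumes "pent a b r s"
  shows "closure (open_sector a b r s) = sector a b r s"
  using closure_open_sector pent_bounds[OF assms] by simp

lemma frontier_edges:
  assumes "pent a b r s"
  shows "{e \<in> edges. e \<subseteq> frontier (open_sector a b r s)} = (\<lambda>(a, b, r, s). sector a b r s) ` sides a b r s"
    (is "?L = ?R")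
proof -
  have F: "open_sector a b r s \<in> plane_faces vertices edges"
    using assms by (auto simp: plane_faces pentagons_def)
  show ?thesis
  proof
    show "?L \<subseteq> ?R"
    proof
      fix e assume L: "e \<in> ?L"
      then obtain a' b' r' s' where e: "edge a' b' r' s'" "e = sector a' b' r' s'"
        by (auto simp: edges_def)
      have "e \<subseteq> sector a b r s"
        using L subset_frontier_iff[OF F, of e] closure_pentagon[OF assms] by blast
      then obtain m where m: "2 * a \<le> a' + b' + 4 * int n * m" "a' + b' + 4 * int n * m \<le> 2 * b"
          "2 * r \<le> r' + s'" "r' + s' \<le> 2 * s"
        using midpoint_in_sector[OF e(1)] pent_bounds(1)[OF assms] e(2) by metis
      then have "(a' + 2 * int n * m, b' + 2 * int n * m, r', s') \<in> sides a b r s"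
        using edge_shift[OF e(1), of m] by (simp add: sides_def algebra_simps)
      then show "e \<in> ?R"
        using sector_shift[of a' m b' r' s'] e(2) by (intro image_eqI[rotated]) auto
    qed
    show "?R \<subseteq> ?L"
    proof
      fix e assume "e \<in> ?R"
      then obtain a' b' r' s' where q: "(a', b', r', s') \<in> sides a b r s" "e = sector a' b' r' s'"
        by auto
      then have "e \<in> edges" by (auto simp: sides_def edges_def)
      moreover have "e \<subseteq> sector a b r s"
        using sides_within[OF assms q(1)] q(2) by (simp add: sector_mono)
      ultimately show "e \<in> ?L"
        using subset_frontier_iff[OF F] closure_pentagon[OF assms] by simp
    qed
  qed
qed

lemma midpoint_not_vertex:
  assumes "edge a b r s" "vtx k j"
  shows "(a + b, r + s) \<noteq> (2 * k, 2 * j)"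
proof
  assume eq: "(a + b, r + s) = (2 * k, 2 * j)"
  note bounds = edge_bounds[OF assms(1)]
  have "(k, j) = (a, r) \<or> (k, j) = (b, s)"
    using edge_vertex[OF assms(1,2)] eq bounds by auto
  then show False using eq bounds by auto
qed

text \<open>Ensures five different edges. If two sides are the same set, the midpoint of one is a
  nonvertex point of the other; both lie within width 6, so the shift vanishes and
  \<open>edge_unique\<close> applies.\<close>

lemma inj_on_sides:
  assumes "pent a b r s"
  shows "inj_on (\<lambda>(a, b, r, s). sector a b r s) (sides a b r s)"
proof (rule inj_onI)
  fix p q assume "p \<in> sides a b r s" "q \<in> sides a b r s"
    and "(\<lambda>(a, b, r, s). sector a b r s) p = (\<lambda>(a, b, r, s). sector a b r s) q"
  then obtain a1 b1 r1 s1 a2 b2 r2 s2 where p: "p = (a1, b1, r1, s1)" and q: "q = (a2, b2, r2, s2)"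
    and q1: "(a1, b1, r1, s1) \<in> sides a b r s" and q2: "(a2, b2, r2, s2) \<in> sides a b r s"
    and eq: "sector a1 b1 r1 s1 = sector a2 b2 r2 s2"
    by (cases p; cases q) auto
  have e1: "edge a1 b1 r1 s1" and e2: "edge a2 b2 r2 s2"
    using q1 q2 by (auto simp: sides_def)
  obtain m where m: "2 * a2 \<le> a1 + b1 + 4 * int n * m" "a1 + b1 + 4 * int n * m \<le> 2 * b2"
      "2 * r2 \<le> r1 + s1" "r1 + s1 \<le> 2 * s2"
    using midpoint_in_sector[OF e1, of a2 b2 r2 s2] edge_bounds(1)[OF e2] eq by blast
  have "\<bar>4 * int n * m\<bar> < 4 * int n * 1"
    using m sides_within[OF assms q1] sides_within[OF assms q2] pent_bounds(5)[OF assms]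
      edge_bounds(5)[OF e1] edge_bounds(5)[OF e2] n_ge by linarith
  then have "m = 0" using n_pos by (simp add: abs_mult)
  then have m: "2 * a2 \<le> a1 + b1" "a1 + b1 \<le> 2 * b2" using m by simp_all
  show "p = q"
    unfolding p q using edge_unique[OF e1, of "a1 + b1" "r1 + s1" a2 b2 r2 s2] e2 m \<open>2 * r2 \<le> _\<close> \<open>_ \<le> 2 * s2\<close>
      edge_bounds[OF e1] midpoint_not_vertex[OF e1] by auto
qed

subsection \<open>Face lengths and the outer cycle\<close>

text \<open>The conditions \<open>a' <= b\<close> and \<open>a <= b'\<close> rule out copies that
  differ by a full turn.\<close>

lemma same_pentagon:
  assumes "pent a b r s" "pent a' b' r' s'" "open_sector a b r s = open_sector a' b' r' s'"
    and "a' \<le> b" "a \<le> b'"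
  shows "(a, b, r, s) = (a', b', r', s')"
proof -
  note bounds = pent_bounds[OF assms(1)] pent_bounds[OF assms(2)]
  let ?x = "(a + b) / 2 :: real" and ?y = "(r + s) / 2 :: real"
  have "pt ?x ?y \<in> open_sector a b r s"
    unfolding open_sector_def using bounds by (intro image_eqI[of _ _ "(?x, ?y)"]) auto
  moreover have "0 < ?y" using bounds by auto
  ultimately obtain m :: int where m: "r' < ?y" "?y < s'" "a' < ?x + 2 * real n * of_int m"
      "?x + 2 * real n * of_int m < b'"
    using pt_in_open_sector_iff bounds(6) assms(3) by blast
  have "real_of_int (2 * a') < real_of_int (a + b + 4 * int n * m)"
    "real_of_int (a + b + 4 * int n * m) < real_of_int (2 * b')"
    "real_of_int (2 * r') < real_of_int (r + s)" "real_of_int (r + s) < real_of_int (2 * s')"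
    using m by (simp_all add: field_simps)
  then have le: "2 * a' < a + b + 4 * int n * m" "a + b + 4 * int n * m < 2 * b'"
      "2 * r' < r + s" "r + s < 2 * s'"
    unfolding of_int_less_iff by auto
  have "\<bar>4 * int n * m\<bar> < 4 * int n * 1"
    using le bounds assms(4,5) n_ge by linarith
  then have "m = 0" using n_pos by (simp add: abs_mult)
  then show ?thesis
    using pent_unique[OF assms(1), of "a + b" "r + s" a' b' r' s'] assms(2) le bounds by simp
qed

lemma frontier_exterior: "frontier exterior = sphere 0 3"
  by (simp add: exterior_eq frontier_complement frontier_cball)

text \<open>Gives every edge weight 1 in \<open>face_length\<close>, which thus becomes a plain
  count of frontier edges.\<close>

lemma two_faces:
  assumes "e \<in> edges"
  obtains F F' where "F \<in> plane_faces vertices edges" "F' \<in> plane_faces vertices edges" "F \<noteq> F'"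
    "e \<subseteq> frontier F" "e \<subseteq> frontier F'"
proof -
  obtain a b r s where e: "edge a b r s" "e = sector a b r s"
    using assms by (auto simp: edges_def)
  have face: "open_sector a' b' r' s' \<in> plane_faces vertices edges"
    and bound: "e \<subseteq> frontier (open_sector a' b' r' s')"
    if "pent a' b' r' s'" "a' \<le> a" "b \<le> b'" "r' \<le> r" "s \<le> s'" for a' b' r' s'
  proof -
    show F: "open_sector a' b' r' s' \<in> plane_faces vertices edges"
      using that(1) by (auto simp: plane_faces pentagons_def)
    show "e \<subseteq> frontier (open_sector a' b' r' s')"
      using subset_frontier_iff[OF F assms] closure_pentagon[OF that(1)] sector_mono[OF that(2-5)] e(2) by simp
  qed
  show thesis
  proof (cases "r < 3")
    case True
    obtain a1 b1 r1 s1 a2 b2 r2 s2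
      where p1: "pent a1 b1 r1 s1" "a1 \<le> a" "b \<le> b1" "r1 \<le> r" "s \<le> s1"
        and p2: "pent a2 b2 r2 s2" "a2 \<le> a" "b \<le> b2" "r2 \<le> r" "s \<le> s2"
        and ne: "(a1, b1, r1, s1) \<noteq> (a2, b2, r2, s2)"
      using edge_two_sides[OF e(1) True] by metis
    have "open_sector a1 b1 r1 s1 \<noteq> open_sector a2 b2 r2 s2"
      using same_pentagon[OF p1(1) p2(1)] ne p1 p2 edge_bounds(5)[OF e(1)] by linarith
    then show thesis
      using that face[OF p1] face[OF p2] bound[OF p1] bound[OF p2] by blast
  next
    case False
    then have o: "odd a" "b = a + 2" "r = 3" "s = 3"
      using e(1) by (auto elim: edge.cases)
    have p: "pent a b 2 3" using o outer_pent by simp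
    have "exterior \<noteq> open_sector a b 2 3"
      using exterior_disjoint_pentagon[of "open_sector a b 2 3"] face_open_connected[of exterior] p
      by (auto simp: pentagons_def)
    moreover have "e \<subseteq> frontier exterior"
      using norm_edge[OF e(1)] e(2) o by (force simp: frontier_exterior)
    ultimately show thesis
      using that[of exterior "open_sector a b 2 3"] face[OF p] bound[OF p] o by (simp add: plane_faces)
  qed
qed

lemma face_length_eq:
  "face_length vertices edges F = card {e \<in> edges. e \<subseteq> frontier F}"
proof -
  have "\<exists>F' \<in> plane_faces vertices edges. F' \<noteq> F \<and> e \<subseteq> frontier F'" if "e \<in> edges" for e
    using two_faces[OF that] by metis
  then show ?thesis
    unfolding face_length_def by simp
qed

lemma face_length_pentagon:
  assumes "F \<in> pentagons"
  shows "face_length vertices edges F = 5"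
proof -
  obtain a b r s where F: "pent a b r s" "F = open_sector a b r s"
    using assms by (auto simp: pentagons_def)
  then show ?thesis
    using card_image[OF inj_on_sides[OF F(1)]] card_sides[OF F(1)]
    by (simp add: face_length_eq frontier_edges)
qed

section \<open>The outer cycle\<close>

definition corner :: "int \<Rightarrow> complex" where
  "corner i = pt (of_int (2 * i + 1)) (of_int 3)"

lemma corner_eq_iff: "corner i = corner j \<longleftrightarrow> (\<exists>m. j = i + int n * m)"
proof -
  have "corner i = corner j \<longleftrightarrow> (\<exists>m::int. real_of_int (2 * j + 1) = real_of_int (2 * i + 1) + 2 * real n * of_int m)"
    unfolding corner_def by (subst pt_eq_iff) auto
  also have "\<dots> \<longleftrightarrow> (\<exists>m. j = i + int n * m)"
  proof (intro iff_exI)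
    fix m
    have "real_of_int (2 * j + 1) = real_of_int (2 * i + 1) + 2 * real n * of_int m \<longleftrightarrow>
        real_of_int (2 * j + 1) = real_of_int (2 * i + 1 + 2 * (int n * m))"
      by (simp add: mult.assoc)
    also have "\<dots> \<longleftrightarrow> j = i + int n * m"
      unfolding of_int_eq_iff by auto
    finally show "real_of_int (2 * j + 1) = real_of_int (2 * i + 1) + 2 * real n * of_int m \<longleftrightarrow> j = i + int n * m" .
  qed
  finally show ?thesis .
qed

lemma corner_inj:
  assumes "corner i = corner j" "\<bar>i - j\<bar> < int n"
  shows "i = j"
proof -
  obtain m where m: "j = i + int n * m" using assms(1) corner_eq_iff by blast
  then have "\<bar>int n * m\<bar> < int n * 1" using assms(2) by simp
  then have "m = 0" using n_pos by (simp add: abs_mult)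
  then show ?thesis using m by simp
qed

definition rim :: "int \<Rightarrow> complex set" where
  "rim i = sector (2 * i + 1) (2 * i + 3) 3 3"

lemma edge_rim: "edge (2 * i + 1) (2 * i + 3) 3 3"
  using outer_arc[of "2 * i + 1"] by (simp add: add.commute)

lemma rim_in_edges: "rim i \<in> edges"
  unfolding rim_def edges_def using edge_rim by blast

lemma rim_ends: "rim i \<inter> vertices = {corner i, corner (i + 1)}"
  using edge_inter_vertices[OF edge_rim[of i]] by (simp add: rim_def corner_def add.commute)

lemma rim_shift: "rim (i + int n * m) = rim i"
  using sector_shift[of "2 * i + 1" m "2 * i + 3" 3 3] by (simp add: rim_def algebra_simps)

lemma rim_mod: "rim (i mod int n) = rim i"
  using rim_shift[of "i mod int n" "i div int n"] by simp

lemma frontier_exterior_edges: "{e \<in> edges. e \<subseteq> frontier exterior} = rim ` {0..<int n}"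
proof
  show "rim ` {0..<int n} \<subseteq> {e \<in> edges. e \<subseteq> frontier exterior}"
  proof
    fix e assume "e \<in> rim ` {0..<int n}"
    then obtain i where i: "e = rim i" by blast
    have "cmod z = 3" if "z \<in> rim i" for z
      using norm_edge[OF edge_rim, of z i] that by (simp add: rim_def)
    then show "e \<in> {e \<in> edges. e \<subseteq> frontier exterior}"
      using rim_in_edges i by (auto simp: frontier_exterior)
  qed
  show "{e \<in> edges. e \<subseteq> frontier exterior} \<subseteq> rim ` {0..<int n}"
  proof
    fix e assume "e \<in> {e \<in> edges. e \<subseteq> frontier exterior}"
    then obtain a b r s where e: "edge a b r s" "e = sector a b r s" and sub: "sector a b r s \<subseteq> sphere 0 3"
      by (auto simp: edges_def frontier_exterior)
    have "pt (of_int a) (of_int r) \<in> sphere 0 3"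
      using edge_inter_vertices[OF e(1)] sub by auto
    then have "r = 3" using edge_bounds(1)[OF e(1)] by simp
    then have o: "odd a" "b = a + 2" "s = 3"
      using e(1) by (auto elim: edge.cases)
    then obtain i where "a = 2 * i + 1" by (elim oddE)
    then have "e = rim i" using e(2) o \<open>r = 3\<close> by (simp add: rim_def add.commute)
    then have "e = rim (i mod int n)" by (simp add: rim_mod)
    then show "e \<in> rim ` {0..<int n}" using n_pos by simp
  qed
qed

lemma inj_on_rim: "inj_on rim {0..<int n}"
proof (rule inj_onI)
  fix i j assume ij: "i \<in> {0..<int n}" "j \<in> {0..<int n}" "rim i = rim j"
  have "{corner i, corner (i + 1)} = {corner j, corner (j + 1)}"
    using rim_ends ij(3) by metis
  then consider "corner i = corner j" | "corner i = corner (j + 1)" "corner (i + 1) = corner j"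
    by (auto simp: doubleton_eq_iff)
  then show "i = j"
  proof cases
    case 1
    then show ?thesis using corner_inj ij by auto
  next
    case 2
    obtain m where m: "j + 1 = i + int n * m" using 2(1) corner_eq_iff by blast
    obtain m' where m': "j = i + 1 + int n * m'" using 2(2) corner_eq_iff by blast
    \<comment> \<open>Swapped ends would mean that two steps lead once around the outer
      cycle.\<close>
    have "int n * (m - m') = 2" using m m' by (simp add: algebra_simps)
    then have "int n dvd 2" by (metis dvd_triv_left)
    then have "int n \<le> 2" by (rule zdvd_imp_le) simp
    then show ?thesis using n_ge by simp
  qed
qed

lemma face_length_exterior: "face_length vertices edges exterior = n"
  using card_image[OF inj_on_rim] by (simp add: face_length_eq frontier_exterior_edges)

lemma sphere_eq_rims: "sphere 0 3 = \<Union>(rim ` {0..<int n})"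
proof
  show "\<Union>(rim ` {0..<int n}) \<subseteq> sphere 0 3"
    using frontier_exterior_edges frontier_exterior by auto
  show "sphere 0 3 \<subseteq> \<Union>(rim ` {0..<int n})"
  proof
    fix z :: complex assume "z \<in> sphere 0 3"
    moreover obtain x y where "0 \<le> y" "z = pt x y" using pt_surj .
    ultimately have z: "z = pt x 3" by simp
    define i where "i = (\<lfloor>x\<rfloor> - 1) div 2"
    have "2 * i + 1 \<le> \<lfloor>x\<rfloor>" "\<lfloor>x\<rfloor> < 2 * i + 3" unfolding i_def by presburger+
    then have "real_of_int (2 * i + 1) \<le> x" "x \<le> real_of_int (2 * i + 3)" by linarith+
    then have "z \<in> rim i"
      unfolding z rim_def sector_def by (intro image_eqI[of _ _ "(x, 3)"]) auto
    then have "z \<in> rim (i mod int n)" by (simp add: rim_mod)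
    then show "z \<in> \<Union>(rim ` {0..<int n})" using n_pos by (intro UN_I) auto
  qed
qed

lemma edge_with_rim_ends:
  assumes "e \<in> edges" "e \<inter> vertices = {corner i, corner (i + 1)}"
  shows "e = rim i"
  using inj_onD[OF inj_on_edge_ends, of e "rim i"] assms rim_in_edges rim_ends by simp

definition rim_arcs :: "(complex \<times> complex) list" where
  "rim_arcs = map (\<lambda>i. (corner (int i), corner (int i + 1))) [0..<n]"

text \<open>The starting corner is general for the sake of the induction; the outer cycle is the
  case \<open>i = 0\<close>, \<open>k = n\<close>, where the last corner equals the initial
  one.\<close>

lemma cas_corners:
  "pre_digraph.cas (abstract_graph vertices edges) (corner (int i))
     (map (\<lambda>i. (corner (int i), corner (int i + 1))) [i..<i + k]) (corner (int (i + k)))"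
proof (induction k arbitrary: i)
  case 0
  then show ?case by (simp add: pre_digraph.cas.simps)
next
  case (Suc k)
  have "[i..<i + Suc k] = i # [Suc i..<Suc i + k]" by (simp add: upt_conv_Cons)
  then show ?case
    using Suc.IH[of "Suc i"] by (simp add: pre_digraph.cas.simps abstract_graph_def add.commute)
qed

lemma bounded_by_cycle: "bounded_by_cycle vertices edges exterior n"
proof -
  let ?G = "abstract_graph vertices edges"
  have "set rim_arcs \<subseteq> arcs ?G"
  proof
    fix x assume "x \<in> set rim_arcs"
    then obtain i where "x = (corner (int i), corner (int i + 1))" by (auto simp: rim_arcs_def)
    then show "x \<in> arcs ?G"
      using rim_in_edges[of "int i"] rim_ends[of "int i"] unfolding abstract_graph_def by auto
  qed
  moreover have "corner 0 \<in> verts ?G"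
    using vertexI[OF outer[of 1]] by (simp add: corner_def abstract_graph_def)
  moreover have "corner (int n) = corner 0"
    using corner_eq_iff[of "int n" 0] by (metis add.right_inverse mult_minus1_right)
  then have cas: "pre_digraph.cas ?G (corner 0) rim_arcs (corner 0)"
    using cas_corners[of 0 n] by (simp add: rim_arcs_def)
  moreover have "rim_arcs \<noteq> []"
    using n_pos by (simp add: rim_arcs_def)
  then have "tl (pre_digraph.awalk_verts ?G (corner 0) rim_arcs) = map (head ?G) rim_arcs"
    unfolding pre_digraph.awalk_verts_conv'[OF cas] by simp
  then have "tl (pre_digraph.awalk_verts ?G (corner 0) rim_arcs) = map (\<lambda>i. corner (int i + 1)) [0..<n]"
    by (simp add: rim_arcs_def abstract_graph_def)
  moreover have "distinct (map (\<lambda>i. corner (int i + 1)) [0..<n])"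
    unfolding distinct_map
  proof (intro conjI inj_onI)
    fix i j assume "i \<in> set [0..<n]" "j \<in> set [0..<n]" "corner (int i + 1) = corner (int j + 1)"
    then show "i = j" using corner_inj[of "int i + 1" "int j + 1"] by auto
  qed simp
  ultimately have "pre_digraph.cycle ?G rim_arcs"
    using n_pos unfolding pre_digraph.cycle_def pre_digraph.awalk_def
    by (intro exI[of _ "corner 0"] conjI) (simp_all add: rim_arcs_def)
  moreover have "{e \<in> edges. \<exists>(u, v) \<in> set rim_arcs. e \<inter> vertices = {u, v}} = rim ` {0..<int n}"
  proof
    show "{e \<in> edges. \<exists>(u, v) \<in> set rim_arcs. e \<inter> vertices = {u, v}} \<subseteq> rim ` {0..<int n}"
    proof
      fix e assume "e \<in> {e \<in> edges. \<exists>(u, v) \<in> set rim_arcs. e \<inter> vertices = {u, v}}"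
      then obtain i where "e \<in> edges" "e \<inter> vertices = {corner (int i), corner (int i + 1)}" "i < n"
        by (auto simp: rim_arcs_def)
      then show "e \<in> rim ` {0..<int n}"
        using edge_with_rim_ends[of e "int i"] by auto
    qed
    show "rim ` {0..<int n} \<subseteq> {e \<in> edges. \<exists>(u, v) \<in> set rim_arcs. e \<inter> vertices = {u, v}}"
    proof
      fix e assume "e \<in> rim ` {0..<int n}"
      then obtain i where i: "e = rim i" "0 \<le> i" "i < int n" by auto
      then have "(corner i, corner (i + 1)) \<in> set rim_arcs"
        unfolding rim_arcs_def set_map by (intro image_eqI[of _ _ "nat i"]) auto
      then show "e \<in> {e \<in> edges. \<exists>(u, v) \<in> set rim_arcs. e \<inter> vertices = {u, v}}"
        using i rim_in_edges rim_ends by blast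
    qed
  qed
  then have "frontier exterior = \<Union>{e \<in> edges. \<exists>(u, v) \<in> set rim_arcs. e \<inter> vertices = {u, v}}"
    by (simp add: frontier_exterior sphere_eq_rims)
  ultimately show ?thesis
    unfolding bounded_by_cycle_def using n_ge by (intro exI[of _ rim_arcs]) (simp add: rim_arcs_def)
qed

lemma pentagulation:
  assumes "Digraph_Component.connected (abstract_graph vertices edges)"
  shows "pentagulation n vertices edges exterior"
  unfolding pentagulation_def
proof (intro conjI ballI impI)
  show "exterior \<in> plane_faces vertices edges" by (simp add: plane_faces)
  fix F assume "F \<in> plane_faces vertices edges" "F \<noteq> exterior"
  then show "face_length vertices edges F = 5"
    by (simp add: plane_faces face_length_pentagon)
qed (fact assms plane_graph face_length_exterior bounded_by_cycle)+

section \<open>Counting the pentagons\<close>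

text \<open>Three indexed families: one outer pentagon per corner, one inner pentagon per slot,
  whether it stops at radius 1 or reaches the hub, and one petal per \<open>Start\<close>.\<close>

lemma pentagons_subset:
  "pentagons \<subseteq> (\<lambda>i. open_sector (2 * i + 1) (2 * i + 3) 2 3) ` {0..<int n} \<union>
     (\<lambda>i. open_sector (2 * i) (2 * i + 2) (if t i \<in> {Stop, Spoke} then 0 else 1) 2) ` {0..<int n} \<union>
     (\<lambda>i. open_sector (2 * i) (2 * i + 6) 0 1) ` {i \<in> {0..<int n}. t i = Start}"
  (is "_ \<subseteq> ?A \<union> ?B \<union> ?C")
proof
  fix F assume "F \<in> pentagons"
  then obtain a0 b0 r s where p0: "pent a0 b0 r s" "F = open_sector a0 b0 r s"
    by (auto simp: pentagons_def)
  \<comment> \<open>Turns the rectangle so that its left angle lies between 0 and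
    \<open>2 * n - 1\<close>.\<close>
  define m where "m = - (a0 div (2 * int n))"
  define a b where "a = a0 + 2 * int n * m" and "b = b0 + 2 * int n * m"
  have p: "pent a b r s" "F = open_sector a b r s"
    unfolding a_def b_def using p0 pent_shift open_sector_shift by auto
  have "a = a0 mod (2 * int n)"
    unfolding a_def m_def by (simp add: minus_mult_div_eq_mod[symmetric])
  then have range: "0 \<le> a" "a < 2 * int n" using n_pos by simp_all
  define i where "i = a div 2"
  have i: "i \<in> {0..<int n}" using range by (auto simp: i_def)
  have Ti: "T a = t i" by (simp add: T_def i_def)
  have odd: "a = 2 * i + 1" if "odd a" using that by (simp add: i_def)
  have even: "a = 2 * i" if "even a" using that by (simp add: i_def)
  from p(1) show "F \<in> ?A \<union> ?B \<union> ?C"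
  proof cases
    case outer_pent
    then have "F = open_sector (2 * i + 1) (2 * i + 3) 2 3"
      using p(2) odd by (simp add: add.commute)
    then show ?thesis using i by blast
  next
    case middle_pent
    then have "F = open_sector (2 * i) (2 * i + 2) (if t i \<in> {Stop, Spoke} then 0 else 1) 2"
      using p(2) even Ti by simp
    then show ?thesis using i by blast
  next
    case spoke_pent
    then have "F = open_sector (2 * i) (2 * i + 2) (if t i \<in> {Stop, Spoke} then 0 else 1) 2"
      using p(2) even Ti by simp
    then show ?thesis using i by blast
  next
    case petal
    then have "F = open_sector (2 * i) (2 * i + 6) 0 1" "t i = Start"
      using p(2) even Ti by simp_all
    then show ?thesis using i by blast
  qed
qed

lemma num_pentagons_le:
  "num_pentagons vertices edges exterior \<le> 2 * n + card {i \<in> {0..<int n}. t i = Start}"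
proof -
  let ?A = "(\<lambda>i. open_sector (2 * i + 1) (2 * i + 3) 2 3) ` {0..<int n}"
  let ?B = "(\<lambda>i. open_sector (2 * i) (2 * i + 2) (if t i \<in> {Stop, Spoke} then 0 else 1) 2) ` {0..<int n}"
  let ?C = "(\<lambda>i. open_sector (2 * i) (2 * i + 6) 0 1) ` {i \<in> {0..<int n}. t i = Start}"
  have fin: "finite {i \<in> {0..<int n}. t i = Start}"
    by (rule finite_subset[of _ "{0..<int n}"]) auto
  have "num_pentagons vertices edges exterior \<le> card (?A \<union> ?B \<union> ?C)"
    unfolding num_pentagons_def
  proof (rule card_mono)
    show "{F' \<in> plane_faces vertices edges. F' \<noteq> exterior \<and> face_length vertices edges F' = 5} \<subseteq> ?A \<union> ?B \<union> ?C"
      using pentagons_subset unfolding plane_faces by blast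
  qed (intro finite_UnI finite_imageI fin finite_atLeastLessThan_int)
  also have "\<dots> \<le> card ?A + card ?B + card ?C"
    using card_Un_le[of "?A \<union> ?B" ?C] card_Un_le[of ?A ?B] by linarith
  also have "\<dots> \<le> n + n + card {i \<in> {0..<int n}. t i = Start}"
    using card_image_le[of "{0..<int n}" "\<lambda>i. open_sector (2 * i + 1) (2 * i + 3) 2 3"]
      card_image_le[of "{0..<int n}" "\<lambda>i. open_sector (2 * i) (2 * i + 2) (if t i \<in> {Stop, Spoke} then 0 else 1) 2"]
      card_image_le[OF fin, of "\<lambda>i. open_sector (2 * i) (2 * i + 6) 0 1"]
    by (intro add_mono) simp_all
  finally show ?thesis by simp
qed

subsection \<open>3-connectedness\<close>

definition mid :: "int \<Rightarrow> complex" where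
  "mid j = pt (of_int j) (of_int 2)"

definition inn :: "int \<Rightarrow> complex" where
  "inn i = pt (of_int (2 * i)) (of_int 1)"

lemma norm_corner: "cmod (corner i) = 3"
  by (simp add: corner_def)

lemma norm_mid: "cmod (mid i) = 2"
  by (simp add: mid_def)

lemma norm_inn: "cmod (inn i) = 1"
  by (simp add: inn_def)

lemma distinct_levels [simp]:
  "corner i \<noteq> mid j" "mid j \<noteq> corner i" "corner i \<noteq> inn j" "inn j \<noteq> corner i"
  "mid i \<noteq> inn j" "inn j \<noteq> mid i" "corner i \<noteq> 0" "mid j \<noteq> 0" "inn j \<noteq> 0"
  "0 \<noteq> corner i" "0 \<noteq> mid j" "0 \<noteq> inn j"
  using norm_corner[of i] norm_mid[of j] norm_mid[of i] norm_inn[of j] by auto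

lemma pt_int_inj:
  assumes "pt (of_int i) (of_int r) = pt (of_int j) (of_int r)" "0 < r" "\<bar>i - j\<bar> < 2 * int n"
  shows "i = j"
proof -
  obtain m :: int where "real_of_int j = real_of_int i + 2 * real n * of_int m"
    using pt_eq_iff[of "of_int r" "of_int r"] assms(1,2) by auto
  then have "real_of_int j = real_of_int (i + 2 * int n * m)" by simp
  then have m: "j = i + 2 * int n * m" by (simp only: of_int_eq_iff)
  then have "\<bar>2 * int n * m\<bar> < 2 * int n * 1" using assms(3) by simp
  then have "m = 0" using n_pos by (simp add: abs_mult)
  then show ?thesis using m by simp
qed

lemma mid_inj: "mid i = mid j \<Longrightarrow> \<bar>i - j\<bar> < 2 * int n \<Longrightarrow> i = j"
  using pt_int_inj[of i 2 j] by (simp add: mid_def)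

lemma inn_inj: "inn i = inn j \<Longrightarrow> \<bar>i - j\<bar> < int n \<Longrightarrow> i = j"
  using pt_int_inj[of "2 * i" 1 "2 * j"] by (simp add: inn_def)

text \<open>The bound 16 is just below \<open>2 * n\<close> at \<open>n = 9\<close>; the widest
  comparison comes from slots 0 to 8 around the hub, whose middle vertices are up to 16
  apart.\<close>

lemma mid_neq: "i \<noteq> j \<Longrightarrow> \<bar>i - j\<bar> \<le> 16 \<Longrightarrow> mid i \<noteq> mid j"
  using mid_inj[of i j] n_ge by linarith

lemma inn_neq: "i \<noteq> j \<Longrightarrow> \<bar>i - j\<bar> \<le> 8 \<Longrightarrow> inn i \<noteq> inn j"
  using inn_inj[of i j] n_ge by linarith

lemma vertices_cases:
  assumes "v \<in> vertices"
  obtains "v = 0" | i where "v = inn i" "t i \<noteq> Spoke" | j where "v = mid j" | i where "v = corner i"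
proof -
  obtain x r where v: "v = pt (of_int x) (of_int r)" "vtx x r"
    using assms by (auto simp: vertices_def)
  from v(2) show thesis
  proof cases
    case hub
    then show thesis using v that(1) by simp
  next
    case inner
    then show thesis using v that(2)[of "x div 2"] by (simp add: inn_def T_def)
  next
    case middle
    then show thesis using v that(3)[of x] by (simp add: mid_def)
  next
    case outer
    then obtain i where "x = 2 * i + 1" by (elim oddE)
    then show thesis using outer v that(4)[of i] by (simp add: corner_def)
  qed
qed

lemma corner_in_vertices: "corner i \<in> vertices"
  using vertexI[OF outer[of "2 * i + 1"]] by (simp add: corner_def)

lemma mid_in_vertices: "mid j \<in> vertices"
  using vertexI[OF middle[of j]] by (simp add: mid_def)

lemma inn_in_vertices: "t i \<noteq> Spoke \<Longrightarrow> inn i \<in> vertices"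
  using vertexI[OF inner[of "2 * i"]] by (simp add: inn_def T_def)

definition adj :: "complex \<Rightarrow> complex \<Rightarrow> bool" where
  "adj u v \<longleftrightarrow> (\<exists>e\<in>edges. e \<inter> vertices = {u, v})"

lemma adj_edge: "edge a b r s \<Longrightarrow> adj (pt (of_int a) (of_int r)) (pt (of_int b) (of_int s))"
  unfolding adj_def by (intro bexI[of _ "sector a b r s"] edge_inter_vertices) (auto simp: edges_def)

lemma adj_sym: "adj u v \<Longrightarrow> adj v u"
  unfolding adj_def by (simp only: insert_commute)

lemma adj_corners: "adj (corner i) (corner (i + 1))"
  unfolding adj_def by (intro bexI[of _ "rim i"] rim_ends rim_in_edges)

lemma adj_mids: "adj (mid j) (mid (j + 1))"
  using adj_edge[OF middle_arc] by (simp add: mid_def)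

lemma adj_corner_mid: "adj (corner i) (mid (2 * i + 1))"
  using adj_sym[OF adj_edge[OF outer_ray[of "2 * i + 1"]]] by (simp add: mid_def corner_def)

text \<open>The closed walk of length \<open>n\<close> that runs along the middle cycle on the inside.\<close>

definition below :: "int \<Rightarrow> complex" where
  "below i = (if t i = Spoke then 0 else inn i)"

lemma below_in_vertices: "below i \<in> vertices"
  using inn_in_vertices zero_in_vertices by (simp add: below_def)

lemma below_noncorner [simp]: "below i \<noteq> corner j" "below i \<noteq> mid j" "mid j \<noteq> below i"
  by (simp_all add: below_def)

lemma adj_below_mid: "adj (below i) (mid (2 * i))"
  using adj_edge[OF spoke[of "2 * i"]] adj_edge[OF inner_ray[of "2 * i"]]
  by (simp add: below_def mid_def inn_def T_def)

lemma adj_hub: "t i \<in> {Start, Stop} \<Longrightarrow> adj 0 (inn i)"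
  using adj_edge[OF hub_ray[of "2 * i"]] by (simp add: inn_def T_def)

lemma adj_inns: "t i \<notin> {Stop, Spoke} \<Longrightarrow> adj (inn i) (inn (i + 1))"
  using adj_edge[OF inner_arc[of "2 * i"]] by (simp add: inn_def T_def)

lemma adj_belows: "adj (below i) (below (i + 1))"
proof -
  consider "t i = Stop" | "t i = Spoke" | "t i \<notin> {Stop, Spoke}" by auto
  then show ?thesis
  proof cases
    case 1
    then have "t (i + 1) = Spoke" using t_step[of i] by simp
    then show ?thesis using 1 adj_sym[OF adj_hub[of i]] by (simp add: below_def)
  next
    case 2
    then have "t (i + 1) = Start" using t_step[of i] by simp
    then show ?thesis using 2 adj_hub[of "i + 1"] by (simp add: below_def)
  next
    case 3
    then have "t (i + 1) \<noteq> Spoke" using t_step[of i] by auto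
    then show ?thesis using 3 adj_inns[of i] by (simp add: below_def)
  qed
qed

section \<open>Reachability after deleting at most two vertices\<close>

context
  fixes S :: "complex set"
  assumes S: "S \<subseteq> vertices" "card S < 3"
begin

text \<open>Spelled out in the form of \<open>R\<close> in \<open>connected_induced_plane\<close>,
  so that unfolding makes that lemma applicable.\<close>

definition links :: "(complex \<times> complex) set" where
  "links = {(u, v). u \<in> vertices - S \<and> v \<in> vertices - S \<and> (\<exists>e\<in>edges. e \<inter> vertices = {u, v})}"

definition linked :: "complex \<Rightarrow> complex \<Rightarrow> bool" where
  "linked u v \<longleftrightarrow> (u, v) \<in> links\<^sup>*"

lemma links_iff: "(u, v) \<in> links \<longleftrightarrow> u \<in> vertices - S \<and> v \<in> vertices - S \<and> adj u v"
  by (simp add: links_def adj_def)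

lemma linked_refl: "linked u u"
  by (simp add: linked_def)

lemma linked_trans: "linked u v \<Longrightarrow> linked v w \<Longrightarrow> linked u w"
  unfolding linked_def by (rule rtrancl_trans)

lemma linked_adj: "adj u v \<Longrightarrow> u \<in> vertices - S \<Longrightarrow> v \<in> vertices - S \<Longrightarrow> linked u v"
  unfolding linked_def by (rule r_into_rtrancl) (simp add: links_iff)

lemma linked_sym:
  assumes "linked u v"
  shows "linked v u"
proof -
  have "sym links"
    by (rule symI) (simp add: links_iff adj_sym)
  then show ?thesis
    using assms unfolding linked_def by (rule symD[OF sym_rtrancl])
qed

lemma finite_S: "finite S"
  using S(1) finite_vertices by (rule finite_subset)

lemma linked_chain:
  assumes "\<And>k. i \<le> k \<Longrightarrow> k < j \<Longrightarrow> linked (f k) (f (k + 1))" "i \<le> (j::int)"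
  shows "linked (f i) (f j)"
  using assms(2,1)
proof (induction j rule: int_ge_induct)
  case base
  show ?case by (rule linked_refl)
next
  case (step j)
  show ?case
    by (rule linked_trans[OF step.IH step.prems]) (use step in auto)
qed

text \<open>Among any three consecutive slots one has the hub, or a neighbour of the hub, below it.
  Three disjoint windows give three routes to the middle cycle that share only the hub.\<close>

lemma hub_linked_mid:
  assumes "0 \<notin> S"
  obtains j where "mid j \<notin> S" "linked 0 (mid j)"
proof -
  have exit: "\<exists>i. j \<le> i \<and> i \<le> j + 2 \<and> t i \<in> {Start, Stop, Spoke}" for j
  proof -
    have "t j \<in> {Start, Stop, Spoke} \<or> t (j + 1) \<in> {Start, Stop, Spoke} \<or> t (j + 2) \<in> {Start, Stop, Spoke}"
      using t_step[of j] t_step[of "j + 1"] by (cases "t j") (auto simp: add.assoc)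
    then show ?thesis
    proof (elim disjE)
      assume "t j \<in> {Start, Stop, Spoke}"
      then show ?thesis by (intro exI[of _ j]) simp
    next
      assume "t (j + 1) \<in> {Start, Stop, Spoke}"
      then show ?thesis by (intro exI[of _ "j + 1"]) simp
    next
      assume "t (j + 2) \<in> {Start, Stop, Spoke}"
      then show ?thesis by (intro exI[of _ "j + 2"]) simp
    qed
  qed
  obtain a where a: "0 \<le> a" "a \<le> 2" "t a \<in> {Start, Stop, Spoke}" using exit[of 0] by auto
  obtain b where b: "3 \<le> b" "b \<le> 5" "t b \<in> {Start, Stop, Spoke}" using exit[of 3] by auto
  obtain c where c: "6 \<le> c" "c \<le> 8" "t c \<in> {Start, Stop, Spoke}" using exit[of 6] by auto
  have disjoint: "{mid (2 * i), inn i} \<inter> {mid (2 * j), inn j} = {}" if "i \<noteq> j" "\<bar>i - j\<bar> \<le> 8" for i j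
    using that mid_neq[of "2 * i" "2 * j"] inn_neq[of i j] by auto
  have "{mid (2 * a), inn a} \<inter> S = {} \<or> {mid (2 * b), inn b} \<inter> S = {} \<or> {mid (2 * c), inn c} \<inter> S = {}"
    by (rule disjoint_from_small_set[OF finite_S S(2)]; rule disjoint; use a b c in linarith)
  then obtain i where i: "t i \<in> {Start, Stop, Spoke}" "mid (2 * i) \<notin> S" "inn i \<notin> S"
    using a b c by auto
  have "linked 0 (below i)"
    using i assms linked_refl linked_adj[OF adj_hub[of i]] inn_in_vertices[of i] zero_in_vertices
    by (auto simp: below_def)
  moreover have "below i \<notin> S"
    using i assms by (simp add: below_def)
  then have "linked (below i) (mid (2 * i))"
    using i by (intro linked_adj adj_below_mid) (auto simp: below_in_vertices mid_in_vertices)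
  ultimately show thesis
    using that i(2) linked_trans by metis
qed

text \<open>The three routes are straight up, or one step to either side along the closed walk and
  then up.\<close>

lemma inn_linked_mid:
  assumes "t i \<noteq> Spoke" "inn i \<notin> S"
  obtains j where "mid j \<notin> S" "linked (inn i) (mid j)"
proof -
  have i: "below i = inn i" "inn i \<in> vertices - S"
    using assms inn_in_vertices by (auto simp: below_def)
  have up: "linked (below k) (mid (2 * k))" if "below k \<notin> S" "mid (2 * k) \<notin> S" for k
    using that by (intro linked_adj adj_below_mid) (auto simp: below_in_vertices mid_in_vertices)
  have right: "linked (inn i) (below (i + 1))" if "below (i + 1) \<notin> S"
    using that i adj_belows[of i] by (intro linked_adj) (auto simp: below_in_vertices)
  have left: "linked (inn i) (below (i - 1))" if "below (i - 1) \<notin> S"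
    using that i adj_sym[OF adj_belows[of "i - 1"]] by (intro linked_adj) (auto simp: below_in_vertices)
  have "{mid (2 * i)} \<inter> S = {} \<or> {below (i + 1), mid (2 * (i + 1))} \<inter> S = {} \<or>
      {below (i - 1), mid (2 * (i - 1))} \<inter> S = {}"
  proof (rule disjoint_from_small_set[OF finite_S S(2)])
    show "{mid (2 * i)} \<inter> {below (i + 1), mid (2 * (i + 1))} = {}"
      using mid_neq[of "2 * i" "2 * (i + 1)"] by simp
    show "{mid (2 * i)} \<inter> {below (i - 1), mid (2 * (i - 1))} = {}"
      using mid_neq[of "2 * i" "2 * (i - 1)"] by simp
    \<comment> \<open>The two neighbours could coincide only at the hub, but
      \<open>t (i + 1) = Spoke\<close> requires \<open>t i = Stop\<close>, and
      \<open>t (i - 1) = Spoke\<close> requires \<open>t i = Start\<close>.\<close>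
    have "below (i + 1) \<noteq> below (i - 1)"
      using inn_neq[of "i + 1" "i - 1"] t_step[of i] t_step[of "i - 1"] by (auto simp: below_def)
    then show "{below (i + 1), mid (2 * (i + 1))} \<inter> {below (i - 1), mid (2 * (i - 1))} = {}"
      using mid_neq[of "2 * (i + 1)" "2 * (i - 1)"] by auto
  qed
  then show thesis
  proof (elim disjE)
    assume "{mid (2 * i)} \<inter> S = {}"
    then show thesis using that up[of i] i by auto
  next
    assume "{below (i + 1), mid (2 * (i + 1))} \<inter> S = {}"
    then show thesis using that up[of "i + 1"] right linked_trans by blast
  next
    assume "{below (i - 1), mid (2 * (i - 1))} \<inter> S = {}"
    then show thesis using that up[of "i - 1"] left linked_trans by blast
  qed
qed

text \<open>Hub and inner vertices always reach the middle cycle, so only the two cycles remain to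
  be linked to the root.\<close>

lemma linked_all:
  assumes "\<And>i. corner i \<notin> S \<Longrightarrow> linked r (corner i)" "\<And>j. mid j \<notin> S \<Longrightarrow> linked r (mid j)"
    and "v \<in> vertices - S"
  shows "linked r v"
proof -
  have "v \<in> vertices" and v: "v \<notin> S" using assms(3) by auto
  from this(1) show ?thesis
  proof (cases rule: vertices_cases)
    case 1
    then obtain j where "mid j \<notin> S" "linked 0 (mid j)" using hub_linked_mid v by auto
    then show ?thesis using 1 assms(2)[of j] linked_sym linked_trans by blast
  next
    case (2 i)
    then obtain j where "mid j \<notin> S" "linked (inn i) (mid j)" using inn_linked_mid[of i] v by auto
    then show ?thesis using 2 assms(2)[of j] linked_sym linked_trans by blast
  next
    case (3 j)
    then show ?thesis using assms(2) v by simp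
  next
    case (4 i)
    then show ?thesis using assms(1) v by simp
  qed
qed

lemma linked_corner_mid: "corner i \<notin> S \<Longrightarrow> mid (2 * i + 1) \<notin> S \<Longrightarrow> linked (corner i) (mid (2 * i + 1))"
  using adj_corner_mid by (intro linked_adj) (auto simp: corner_in_vertices mid_in_vertices)

lemma linked_mids: "mid j \<notin> S \<Longrightarrow> mid (j + 1) \<notin> S \<Longrightarrow> linked (mid j) (mid (j + 1))"
  using adj_mids by (intro linked_adj) (auto simp: mid_in_vertices)

lemma linked_corners: "corner i \<notin> S \<Longrightarrow> corner (i + 1) \<notin> S \<Longrightarrow> linked (corner i) (corner (i + 1))"
  using adj_corners by (intro linked_adj) (auto simp: corner_in_vertices)

text \<open>The intact outer cycle is the backbone. The inner level is needed only for an even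
  middle vertex that has lost both neighbours on the middle cycle.\<close>

lemma linked_if_no_corner_deleted:
  assumes "\<And>i. corner i \<notin> S"
  shows "v \<in> vertices - S \<Longrightarrow> linked (corner 0) v"
proof (rule linked_all)
  have step: "linked (corner k) (corner (k + 1))" for k
    using assms by (intro linked_corners)
  have "linked (corner 0) (corner i)" if "0 \<le> i" for i
    using that step by (rule linked_chain[where f = corner and i = 0, rotated])
  moreover have "linked (corner i) (corner 0)" if "i \<le> 0" for i
    using that step by (rule linked_chain[where f = corner and j = 0, rotated])
  ultimately show corner: "linked (corner 0) (corner i)" for i
    using linked_sym[of "corner i" "corner 0"] by (cases "0 \<le> i") auto
  have odd: "linked (corner 0) (mid (2 * i + 1))" if "mid (2 * i + 1) \<notin> S" for i
    using that corner[of i] assms linked_corner_mid linked_trans by blast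
  have even: "linked (corner 0) (mid (2 * i))" if free: "mid (2 * i) \<notin> S" for i
  proof -
    consider "mid (2 * i + 1) \<notin> S" | "mid (2 * i - 1) \<notin> S" | "mid (2 * i + 1) \<in> S" "mid (2 * i - 1) \<in> S"
      by blast
    then show ?thesis
    proof cases
      case 1
      then show ?thesis
        using free odd[of i] linked_mids[of "2 * i"] linked_sym linked_trans by blast
    next
      case 2
      then show ?thesis
        using free odd[of "i - 1"] linked_mids[of "2 * i - 1"] linked_trans[of "corner 0" "mid (2 * i - 1)"]
        by (simp add: algebra_simps)
    next
      case 3
      \<comment> \<open>The two neighbours exhaust \<open>S\<close>, so the detour down to the walk,
        one step along it and up to \<open>mid (2 * i + 2)\<close> is free.\<close>
      have "card {mid (2 * i + 1), mid (2 * i - 1)} = 2"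
        using mid_neq[of "2 * i + 1" "2 * i - 1"] by simp
      then have S_eq: "{mid (2 * i + 1), mid (2 * i - 1)} = S"
        using 3 S(2) finite_S by (intro card_seteq) auto
      have below: "below k \<notin> S" for k
        unfolding S_eq[symmetric] by simp
      have mids: "mid (2 * i + 2) \<notin> S" "mid (2 * i + 3) \<notin> S"
        unfolding S_eq[symmetric] using mid_neq by simp_all
      have "linked (mid (2 * i)) (below i)"
        using free below adj_below_mid[THEN adj_sym]
        by (intro linked_adj) (auto simp: below_in_vertices mid_in_vertices)
      moreover have "linked (below i) (below (i + 1))"
        using below adj_belows by (intro linked_adj) (auto simp: below_in_vertices)
      moreover have "linked (below (i + 1)) (mid (2 * (i + 1)))"
        using mids below[of "i + 1"] adj_below_mid[of "i + 1"]
        by (intro linked_adj) (auto simp: below_in_vertices mid_in_vertices algebra_simps)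
      moreover have "linked (mid (2 * (i + 1))) (mid (2 * (i + 1) + 1))"
        using mids linked_mids[of "2 * (i + 1)"] by (simp add: algebra_simps)
      moreover have "linked (corner 0) (mid (2 * (i + 1) + 1))"
        using mids odd[of "i + 1"] by (simp add: algebra_simps)
      ultimately show ?thesis
        using linked_sym linked_trans by meson
    qed
  qed
  show "linked (corner 0) (mid j)" if "mid j \<notin> S" for j
    using that odd[of "j div 2"] even[of "j div 2"] by (cases "even j") auto
qed

text \<open>The backbone is the outer cycle without \<open>corner p\<close>, a path starting at
  \<open>corner (p + 1)\<close>; apart from it only \<open>w\<close> can be missing.\<close>

lemma linked_if_one_corner_deleted:
  assumes "corner p \<in> S" "S \<subseteq> {corner p, w}" "\<And>i. w \<noteq> corner i"
  shows "v \<in> vertices - S \<Longrightarrow> linked (corner (p + 1)) v"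
proof (rule linked_all)
  have in_S: "corner i \<in> S \<longleftrightarrow> corner i = corner p" "mid j \<in> S \<Longrightarrow> mid j = w" for i j
    using assms by (auto dest: sym)
  have free: "corner (p + k) \<notin> S" if "1 \<le> k" "k < int n" for k
    using that corner_inj[of "p + k" p] in_S(1)[of "p + k"] by auto
  have path: "linked (corner (p + 1)) (corner (p + k))" if "1 \<le> k" "k < int n" for k
  proof (rule linked_chain[of 1 k "\<lambda>k. corner (p + k)"])
    fix i assume "1 \<le> i" "i < k"
    then show "linked (corner (p + i)) (corner (p + (i + 1)))"
      using linked_corners[of "p + i"] free[of i] free[of "i + 1"] that by (simp add: add.assoc)
  qed (rule that(1))
  show corner: "linked (corner (p + 1)) (corner i)" if "corner i \<notin> S" for i
  proof -
    define k where "k = (i - p) mod int n"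
    have "i = p + k + int n * ((i - p) div int n)"
      unfolding k_def by (simp add: minus_div_mult_eq_mod[symmetric] algebra_simps)
    then have eq: "corner (p + k) = corner i" using corner_eq_iff by blast
    have "0 \<le> k" "k < int n" using n_pos by (simp_all add: k_def)
    moreover have "k \<noteq> 0" using eq that assms(1) by auto
    ultimately show ?thesis using path[of k] eq by simp
  qed
  have neighbours: "corner (i + 1) \<notin> S" "corner (i - 1) \<notin> S" if "corner i \<in> S" for i
    using that in_S(1)[of i] in_S(1)[of "i + 1"] in_S(1)[of "i - 1"]
      corner_inj[of "i + 1" i] corner_inj[of "i - 1" i] n_ge by auto
  have odd: "linked (corner (p + 1)) (mid (2 * i + 1))" if this_free: "mid (2 * i + 1) \<notin> S" for i
  proof (cases "corner i \<in> S")
    case False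
    then show ?thesis
      using this_free corner[of i] linked_corner_mid[of i] linked_trans by blast
  next
    case True
    show ?thesis
    \<comment> \<open>The middle vertex at the deleted corner has disjoint detours along the middle
      cycle to the next corner on either side; \<open>w\<close> blocks at most one of them.\<close>
    proof (cases "mid (2 * i + 2) \<in> S \<or> mid (2 * i + 3) \<in> S")
      case True
      have frees: "mid (2 * i) \<notin> S" "mid (2 * i - 1) \<notin> S"
        using True in_S(2) mid_neq[of "2 * i + 2" "2 * i"] mid_neq[of "2 * i + 3" "2 * i"]
          mid_neq[of "2 * i + 2" "2 * i - 1"] mid_neq[of "2 * i + 3" "2 * i - 1"] by auto
      have "linked (corner (i - 1)) (mid (2 * i - 1))"
        using linked_corner_mid[of "i - 1"] frees neighbours(2)[OF \<open>corner i \<in> S\<close>]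
        by (simp add: algebra_simps)
      moreover have "linked (mid (2 * i - 1)) (mid (2 * i))"
        using linked_mids[of "2 * i - 1"] frees by simp
      moreover have "linked (mid (2 * i)) (mid (2 * i + 1))"
        using linked_mids[of "2 * i"] frees this_free by simp
      ultimately show ?thesis
        using corner[OF neighbours(2)[OF \<open>corner i \<in> S\<close>]] linked_trans by meson
    next
      case False
      have "linked (corner (i + 1)) (mid (2 * i + 3))"
        using linked_corner_mid[of "i + 1"] False neighbours(1)[OF \<open>corner i \<in> S\<close>]
        by (simp add: algebra_simps)
      moreover have "linked (mid (2 * i + 2)) (mid (2 * i + 3))"
        using linked_mids[of "2 * i + 2"] False by (simp add: add.assoc)
      moreover have "linked (mid (2 * i + 1)) (mid (2 * i + 2))"
        using linked_mids[of "2 * i + 1"] False this_free by (simp add: add.assoc)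
      ultimately show ?thesis
        using corner[OF neighbours(1)[OF \<open>corner i \<in> S\<close>]] linked_sym linked_trans by meson
    qed
  qed
  have even: "linked (corner (p + 1)) (mid (2 * i))" if free: "mid (2 * i) \<notin> S" for i
  proof (cases "mid (2 * i + 1) \<in> S")
    case True
    then have frees: "mid (2 * i - 1) \<notin> S"
      using in_S(2) mid_neq[of "2 * i + 1" "2 * i - 1"] by auto
    then have "linked (corner (p + 1)) (mid (2 * i - 1))"
      using odd[of "i - 1"] by (simp add: algebra_simps)
    moreover have "linked (mid (2 * i - 1)) (mid (2 * i))"
      using linked_mids[of "2 * i - 1"] frees free by simp
    ultimately show ?thesis using linked_trans by blast
  next
    case False
    then show ?thesis
      using odd[of i] linked_mids[of "2 * i"] free linked_sym linked_trans by blast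
  qed
  show "linked (corner (p + 1)) (mid j)" if "mid j \<notin> S" for j
    using that odd[of "j div 2"] even[of "j div 2"] by (cases "even j") auto
qed

text \<open>Here the middle cycle is intact and every surviving corner hangs on it by its own
  ray.\<close>

lemma linked_if_only_corners_deleted:
  assumes "S \<subseteq> {corner p, corner q}"
  shows "v \<in> vertices - S \<Longrightarrow> linked (mid 0) v"
proof (rule linked_all)
  have free: "mid j \<notin> S" for j using assms by auto
  then have step: "linked (mid k) (mid (k + 1))" for k
    by (intro linked_mids)
  have "linked (mid 0) (mid j)" if "0 \<le> j" for j
    using that step by (rule linked_chain[where f = mid and i = 0, rotated])
  moreover have "linked (mid j) (mid 0)" if "j \<le> 0" for j
    using that step by (rule linked_chain[where f = mid and j = 0, rotated])
  ultimately show mid: "linked (mid 0) (mid j)" for j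
    using linked_sym[of "mid j" "mid 0"] by (cases "0 \<le> j") auto
  show "linked (mid 0) (corner i)" if "corner i \<notin> S" for i
    using that mid[of "2 * i + 1"] free linked_corner_mid[of i] linked_sym linked_trans by blast
qed

lemma connected_after_deletion:
  "Digraph_Component.connected (induce_subgraph (abstract_graph vertices edges) (vertices - S))"
proof -
  obtain u v where uv: "S \<subseteq> {u, v}"
    using subset_doubleton_if_card_less_3[OF finite_S S(2)] .
  have none: "\<exists>r \<in> vertices - S. \<forall>v \<in> vertices - S. linked r v" if "\<And>i. corner i \<notin> S"
    using linked_if_no_corner_deleted[OF that] that[of 0] corner_in_vertices[of 0] by blast
  have one: "\<exists>r \<in> vertices - S. \<forall>v \<in> vertices - S. linked r v"
    if "S \<subseteq> {corner p, w}" "\<And>i. w \<noteq> corner i" for p w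
  \<comment> \<open>The set \<open>{corner p, w}\<close> only bounds \<open>S\<close> from above; if
    \<open>corner p\<close> survives, no corner is deleted.\<close>
  proof (cases "corner p \<in> S")
    case True
    have "corner (p + 1) \<noteq> corner p" using corner_inj[of "p + 1" p] n_ge by auto
    then have "corner (p + 1) \<in> vertices - S"
      using that corner_in_vertices by auto
    then show ?thesis using linked_if_one_corner_deleted[OF True that] by blast
  next
    case False
    then have "corner i \<notin> S" for i using that(1) that(2)[of i] by (metis insert_iff singletonD subsetD)
    then show ?thesis by (rule none)
  qed
  have "\<exists>r \<in> vertices - S. \<forall>v \<in> vertices - S. linked r v"
  proof (cases "\<exists>i. u = corner i")
    case True
    then obtain p where p: "u = corner p" by blast
    show ?thesis
    proof (cases "\<exists>i. v = corner i")
      case True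
      then obtain q where q: "v = corner q" by blast
      then have "mid 0 \<in> vertices - S" using p uv mid_in_vertices by auto
      then show ?thesis using linked_if_only_corners_deleted[of p q] p q uv by blast
    next
      case False
      then show ?thesis using one[of p v] p uv by blast
    qed
  next
    case u: False
    show ?thesis
    proof (cases "\<exists>i. v = corner i")
      case True
      then show ?thesis using one[of _ u] u uv by (metis insert_commute)
    next
      case False
      then have "corner i \<notin> S" for i using u uv by auto
      then show ?thesis by (rule none)
    qed
  qed
  then obtain r where "r \<in> vertices - S" "\<And>v. v \<in> vertices - S \<Longrightarrow> (r, v) \<in> links\<^sup>*"
    by (auto simp: linked_def)
  then show ?thesis
    unfolding links_def by (rule connected_induced_plane)
qed

end

lemma card_vertices_greater: "3 < card vertices"
proof -
  have "card {mid 0, mid 1, mid 2, mid 3} = 4"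
    using mid_neq[of 0] mid_neq[of 1] mid_neq[of 2 3] by (simp add: card_insert_if)
  then show ?thesis
    using card_mono[OF finite_vertices, of "{mid 0, mid 1, mid 2, mid 3}"] mid_in_vertices by simp
qed

lemma three_connected: "k_connected 3 (abstract_graph vertices edges)"
  using card_vertices_greater connected_after_deletion
  by (simp add: k_connected_def abstract_graph_def)

lemma connected: "Digraph_Component.connected (abstract_graph vertices edges)"
proof -
  have "induce_subgraph (abstract_graph vertices edges) vertices = abstract_graph vertices edges"
  proof -
    have "u \<in> vertices \<and> v \<in> vertices" if "e \<inter> vertices = {u, v}" for e u v
      using that by blast
    then have "{p \<in> arcs (abstract_graph vertices edges). fst p \<in> vertices \<and> snd p \<in> vertices} =
        arcs (abstract_graph vertices edges)"
      unfolding abstract_graph_def by fastforce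
    then show ?thesis by (simp add: induce_subgraph_def abstract_graph_def)
  qed
  then show ?thesis
    using connected_after_deletion[of "{}"] by simp
qed

end

subsection \<open>The slot sequence\<close>

definition slot_of :: "int \<Rightarrow> slot" where
  "slot_of x = (if x = 0 then Start else if x = 1 then Left else if x = 2 then Right
    else if x = 3 then Stop else Spoke)"

text \<open>There are \<open>l\<close> blocks of three and after them blocks of five. The triples
  run into the first block of five and form the fan with it; each later block of five is a single
  petal.\<close>

definition phase :: "int \<Rightarrow> int \<Rightarrow> int" where
  "phase l j = (if j < 3 * l then j mod 3 else (j - 3 * l) mod 5)"

lemma phase_step:
  assumes "0 \<le> l" "0 \<le> j"
  shows "(phase l j, phase l (j + 1)) \<in> {(0, 1), (1, 2), (2, 0), (2, 3), (3, 4), (4, 0)}"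
proof -
  consider "j + 1 < 3 * l" | "j + 1 = 3 * l" | "3 * l \<le> j" by linarith
  then show ?thesis
  proof cases
    case 1
    have "(j mod 3 = 0 \<and> (j + 1) mod 3 = 1) \<or> (j mod 3 = 1 \<and> (j + 1) mod 3 = 2) \<or>
        (j mod 3 = 2 \<and> (j + 1) mod 3 = 0)"
      by presburger
    then show ?thesis using 1 by (auto simp: phase_def)
  next
    case 2
    then have "j mod 3 = 2" by presburger
    then show ?thesis using 2 by (simp add: phase_def)
  next
    case 3
    define x where "x = j - 3 * l"
    have "(x mod 5 = 0 \<and> (x + 1) mod 5 = 1) \<or> (x mod 5 = 1 \<and> (x + 1) mod 5 = 2) \<or>
        (x mod 5 = 2 \<and> (x + 1) mod 5 = 3) \<or> (x mod 5 = 3 \<and> (x + 1) mod 5 = 4) \<or>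
        (x mod 5 = 4 \<and> (x + 1) mod 5 = 0)"
      by presburger
    moreover have "phase l j = x mod 5" "phase l (j + 1) = (x + 1) mod 5"
      using 3 by (simp_all add: phase_def x_def algebra_simps)
    ultimately show ?thesis by auto
  qed
qed

lemma pentagon_pattern_exists:
  fixes n :: nat and k l :: int
  assumes "9 \<le> n" "int n = 5 * k + 3 * l" "0 < k" "0 \<le> l"
  obtains t where "pentagon_pattern n t" "int (card {i \<in> {0..<int n}. t i = Start}) \<le> k + l"
proof
  define t where "t i = slot_of (phase l (i mod int n))" for i
  show "pentagon_pattern n t"
  proof
    show "9 \<le> n" by fact
    show "t (i + int n) = t i" for i by (simp add: t_def)
    show "(t i, t (i + 1)) \<in> {(Start, Left), (Left, Right), (Right, Start), (Right, Stop), (Stop, Spoke), (Spoke, Start)}" for i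
    proof -
      define j where "j = i mod int n"
      have j: "0 \<le> j" "j < int n" using assms(1) by (simp_all add: j_def)
      have "(i + 1) mod int n = (j + 1) mod int n"
        by (simp add: j_def mod_add_left_eq)
      then have succ: "(i + 1) mod int n = (if j + 1 = int n then 0 else j + 1)"
        using j by simp
      have "(phase l j, phase l ((i + 1) mod int n)) \<in> {(0, 1), (1, 2), (2, 0), (2, 3), (3, 4), (4, 0)}"
      proof (cases "j + 1 = int n")
        case True
        \<comment> \<open>At the seam: since \<open>0 < k\<close>, the last block has length five,
          so the period ends with \<open>Spoke\<close> and may restart with
          \<open>Start\<close>.\<close>
        then have "j - 3 * l = 5 * k - 1" "3 * l \<le> j" using assms by linarith+
        then have "phase l j = 4" by (simp add: phase_def) presburger
        moreover have "phase l 0 = 0" using assms(4) by (simp add: phase_def)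
        ultimately show ?thesis using succ True by simp
      next
        case False
        then show ?thesis using succ phase_step[OF assms(4) j(1)] by simp
      qed
      then show ?thesis by (auto simp: t_def j_def[symmetric] slot_of_def)
    qed
  qed
  \<comment> \<open>Each block, of either length, contains exactly one \<open>Start\<close>, at its
    beginning.\<close>
  have "{i \<in> {0..<int n}. t i = Start} \<subseteq> (\<lambda>m. 3 * m) ` {0..<l} \<union> (\<lambda>m. 3 * l + 5 * m) ` {0..<k}"
  proof
    fix i assume "i \<in> {i \<in> {0..<int n}. t i = Start}"
    then have i: "0 \<le> i" "i < int n" "phase l i = 0"
      by (auto simp: t_def slot_of_def split: if_splits)
    show "i \<in> (\<lambda>m. 3 * m) ` {0..<l} \<union> (\<lambda>m. 3 * l + 5 * m) ` {0..<k}"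
    proof (cases "i < 3 * l")
      case True
      then have "i = 3 * (i div 3)" using i(3) by (simp add: phase_def) presburger
      then show ?thesis using True i(1) by (intro UnI1 image_eqI[of _ _ "i div 3"]) auto
    next
      case False
      then have "(i - 3 * l) mod 5 = 0" using i(3) by (simp add: phase_def)
      then have "i = 3 * l + 5 * ((i - 3 * l) div 5)" by presburger
      moreover then have "(i - 3 * l) div 5 < k" "0 \<le> (i - 3 * l) div 5"
        using False i(2) assms(2) by linarith+
      ultimately show ?thesis by (intro UnI2 image_eqI[of _ _ "(i - 3 * l) div 5"]) auto
    qed
  qed
  then have "card {i \<in> {0..<int n}. t i = Start} \<le>
      card ((\<lambda>m. 3 * m) ` {0..<l} \<union> (\<lambda>m. 3 * l + 5 * m) ` {0..<k})"
    by (intro card_mono) auto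
  also have "\<dots> \<le> card ((\<lambda>m. 3 * m) ` {0..<l}) + card ((\<lambda>m. 3 * l + 5 * m) ` {0..<k})"
    by (rule card_Un_le)
  also have "\<dots> \<le> card {0..<l} + card {0..<k}"
    by (intro add_mono card_image_le) simp_all
  finally show "int (card {i \<in> {0..<int n}. t i = Start}) \<le> k + l"
    using assms(3,4) by simp
qed

theorem theorem1p3:
  fixes n :: nat and k l :: int
  assumes "13 \<le> n"
    and "int n = 5 * k + 3 * l"
    and "0 \<le> l" and "l \<le> 4"
  shows "Pg n \<le> enat (nat (2 * int n + k + l))"
proof -
  \<comment> \<open>Positivity of \<open>k\<close> is where 13 and 4 meet:
    \<open>5 * k = n - 3 * l\<close> is at least \<open>13 - 12\<close>.\<close>
  have n: "9 \<le> n" and k: "0 < k" using assms by linarith+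
  obtain t where t: "pentagon_pattern n t"
    and card: "int (card {i \<in> {0..<int n}. t i = Start}) \<le> k + l"
    by (rule pentagon_pattern_exists[OF n assms(2) k assms(3)])
  interpret pentagon_pattern n t by (rule t)
  have "Pg n \<le> enat (num_pentagons vertices edges exterior)"
    unfolding Pg_def
    by (intro Inf_lower CollectI exI conjI) (rule refl pentagulation connected three_connected)+
  also have "\<dots> \<le> enat (nat (2 * int n + k + l))"
  proof -
    have "num_pentagons vertices edges exterior \<le> nat (2 * int n + k + l)"
      using num_pentagons_le card by linarith
    then show ?thesis by simp
  qed
  finally show ?thesis .
qed

end
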